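(* Let $p\ge 2$, $n>p$, and let $\mathbf X_1,\dots,\mathbf X_n$ be i.i.d. $N_p(\boldsymbol\theta,\boldsymbol\Sigma)$ with $\boldsymbol\Sigma\in\mathcal M$ unknown. Let $\mathcal C$ be either the positive orthant $\mathcal O_p^+$ or the half-space $\mathcal H_p^*$, and let $0<\alpha<1$. For the problem of testing $H_0:\boldsymbol\theta=\mathbf 0$ against $H_1:\boldsymbol\theta\in\mathcal C\setminus\{\mathbf 0\}$, the level-$\alpha$ union-intersection test (UIT) is not a proper Bayes test.
   Context: $\mathcal M$ is the set of all $p\times p$ real symmetric positive definite matrices; $\mathcal O_p^+=\{\boldsymbol\theta\in\mathbb R^p:\boldsymbol\theta\ge\mathbf 0\text{ componentwise}\}$; $\mathcal H_p^*=\{\boldsymbol\theta\in\mathbb R^p:\theta_p\ge 0\}$. $\bar{\mathbf X}_n=n^{-1}\sum_i\mathbf X_i$ and $\mathbf S_n=(n-1)^{-1}\sum_i(\mathbf X_i-\bar{\mathbf X}_n)(\mathbf X_i-\bar{\mathbf X}_n)'$, which is positive definite with probability one. UIT: for positive definite $\mathbf A$, let $\langle\mathbf x,\mathbf y\rangle_{\mathbf A}=\mathbf x'\mathbf A^{-1}\mathbf y$ with norm $\|\cdot\|_{\mathbf A}$, and let $\pi_{\mathbf A}(\mathbf x;\mathcal C)$ be the orthogonal projection of $\mathbf x$ onto $\mathcal C$ for this inner product. The UIT statistic is $U_{\mathcal C}=\|\pi_{\mathbf S_n}(n^{1/2}\bar{\mathbf X}_n;\mathcal C)\|^2_{\mathbf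 S_n}$. The level-$\alpha$ UIT has acceptance region $\{U_{\mathcal C}\le u_\alpha\}$, where $u_\alpha>0$ satisfies $\sup_{\boldsymbol\Sigma\in\mathcal M}P_{\mathbf 0,\boldsymbol\Sigma}\{U_{\mathcal C}\ge u_\alpha\}=\alpha$. Proper Bayes test: let $f(\cdot\mid\boldsymbol\theta,\boldsymbol\Sigma)$ be the joint density of $\mathbf X_1,\dots,\mathbf X_n$. A test is a proper Bayes test if there are a probability measure $G_0$ on $\{\mathbf 0\}\times\mathcal M$, a probability measure $G_1$ on $(\mathcal C\setminus\{\mathbf 0\})\times\mathcal M$ and a constant $c\in(0,\infty)$ such that, up to Lebesgue-null sets, the test rejects $H_0$ where $\int f\,dG_1>c\int f\,dG_0$ and accepts $H_0$ where $\int f\,dG_1<c\int f\,dG_0$. *)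

theory Defs
  imports "HOL-Probability.Probability"
begin

text \<open>A data set of \<open>n = CARD('n)\<close> observations in \<open>p\<close>-space, \<open>p = CARD('p)\<close>, is a point
  \<open>x :: real ^ 'p ^ 'n\<close>; the \<open>i\<close>-th observation is \<open>x $ i\<close>.\<close>

definition spd_matrices :: "(real ^ 'p ^ 'p) set" where
  "spd_matrices = {A. transpose A = A \<and> (\<forall>v. v \<noteq> 0 \<longrightarrow> v \<bullet> (A *v v) > 0)}"

definition pos_orthant :: "(real ^ 'p) set" where
  "pos_orthant = {\<theta>. \<forall>j. \<theta> $ j \<ge> 0}"

text \<open>The linear order on the index type only serves to name the last coordinate.\<close>

definition last_half_space :: "(real ^ 'p :: {finite, linorder}) set" where
  "last_half_space = {\<theta>. \<theta> $ Max UNIV \<ge> 0}"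

definition sample_mean :: "real ^ 'p ^ 'n \<Rightarrow> real ^ 'p" where
  "sample_mean x = (1 / real CARD('n)) *\<^sub>R (\<Sum>i\<in>UNIV. x $ i)"

definition sample_cov :: "real ^ 'p ^ 'n \<Rightarrow> real ^ 'p ^ 'p" where
  "sample_cov x = (1 / (real CARD('n) - 1)) *\<^sub>R
     (\<Sum>i\<in>UNIV. \<chi> j k. (x $ i - sample_mean x) $ j * (x $ i - sample_mean x) $ k)"


definition mvn_density :: "real ^ 'p \<Rightarrow> real ^ 'p ^ 'p \<Rightarrow> real ^ 'p \<Rightarrow> real" where
  "mvn_density \<theta> \<Sigma> y =
     exp (- ((y - \<theta>) \<bullet> (matrix_inv \<Sigma> *v (y - \<theta>))) / 2) / sqrt ((2 * pi) ^ CARD('p) * det \<Sigma>)"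

definition joint_density :: "real ^ 'p ^ 'n \<Rightarrow> real ^ 'p \<Rightarrow> real ^ 'p ^ 'p \<Rightarrow> real" where
  "joint_density x \<theta> \<Sigma> = (\<Prod>i\<in>UNIV. mvn_density \<theta> \<Sigma> (x $ i))"

definition sample_law :: "real ^ 'p \<Rightarrow> real ^ 'p ^ 'p \<Rightarrow> (real ^ 'p ^ 'n) measure" where
  "sample_law \<theta> \<Sigma> = density lborel (\<lambda>x. ennreal (joint_density x \<theta> \<Sigma>))"


definition inner_wrt :: "real ^ 'p ^ 'p \<Rightarrow> real ^ 'p \<Rightarrow> real ^ 'p \<Rightarrow> real" where
  "inner_wrt A x y = x \<bullet> (matrix_inv A *v y)"

definition norm_wrt :: "real ^ 'p ^ 'p \<Rightarrow> real ^ 'p \<Rightarrow> real" where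
  "norm_wrt A x = sqrt (inner_wrt A x x)"

text \<open>The nearest point of \<open>C\<close>; it exists and is unique when \<open>A\<close> is positive definite and
  \<open>C\<close> is nonempty, closed and convex.\<close>

definition proj_wrt :: "real ^ 'p ^ 'p \<Rightarrow> real ^ 'p \<Rightarrow> (real ^ 'p) set \<Rightarrow> real ^ 'p" where
  "proj_wrt A x C = arg_min_on (\<lambda>y. norm_wrt A (x - y)) C"

text \<open>The statistic is only meaningful when the sample covariance matrix is positive definite.
  If \<open>n > p\<close>, the other data sets form a Lebesgue-null set; the value 0 there keeps the
  statistic Borel measurable.\<close>

definition uit_stat :: "(real ^ 'p) set \<Rightarrow> real ^ 'p ^ 'n \<Rightarrow> real" where
  "uit_stat C x =
     (if sample_cov x \<in> spd_matrices
      then (norm_wrt (sample_cov x)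
              (proj_wrt (sample_cov x) (sqrt (real CARD('n)) *\<^sub>R sample_mean x) C))\<^sup>2
      else 0)"


text \<open>A nonrandomized test is given by its acceptance region \<open>R\<close> in the sample space.
  The priors live on the Borel subspaces \<open>{0} \<times> M\<close> and \<open>(C - {0}) \<times> M\<close>. The marginal
  densities are taken in \<open>[0, \<infinity>]\<close>, since they may be infinite on a null set.\<close>

definition proper_Bayes_test :: "(real ^ 'p) set \<Rightarrow> (real ^ 'p ^ 'n) set \<Rightarrow> bool" where
  "proper_Bayes_test C R \<longleftrightarrow>
     (\<exists>(G0 :: ((real ^ 'p) \<times> (real ^ 'p ^ 'p)) measure) (G1 :: ((real ^ 'p) \<times> (real ^ 'p ^ 'p)) measure)
        (c :: real).
        prob_space G0 \<and> sets G0 = sets (restrict_space borel ({0} \<times> spd_matrices)) \<and>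
        prob_space G1 \<and> sets G1 = sets (restrict_space borel ((C - {0}) \<times> spd_matrices)) \<and>
        c > 0 \<and>
        (AE x in lborel.
           let m0 = (\<integral>\<^sup>+ (\<theta>, \<Sigma>). ennreal (joint_density x \<theta> \<Sigma>) \<partial>G0);
               m1 = (\<integral>\<^sup>+ (\<theta>, \<Sigma>). ennreal (joint_density x \<theta> \<Sigma>) \<partial>G1)
           in (m1 > ennreal c * m0 \<longrightarrow> x \<notin> R) \<and> (m1 < ennreal c * m0 \<longrightarrow> x \<in> R)))"

end

theory Submission
  imports Defs "HOL-Complex_Analysis.Cauchy_Integral_Formula"
begin

text \<open>
  Write \<open>m\<^sub>0\<close>, \<open>m\<^sub>1\<close> for the marginal densities, as functions of \<open>t = \<Sum>\<^sub>i X\<^sub>i\<close> and \<open>V = \<Sum>\<^sub>i X\<^sub>i X\<^sub>i'\<close>.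
  They are continuous wherever the sample covariance is positive definite, so the Bayes property
  gives signs of \<open>m\<^sub>1 - c m\<^sub>0\<close> everywhere in the interiors of the acceptance and rejection regions. If the
  sample mean lies in the cone, the UIT statistic is Hotelling's statistic, so \<open>m\<^sub>1 = c m\<^sub>0\<close> on the part of
  the Hotelling surface over the interior of the cone. This surface contains line segments of the form
  \<open>{(\<rho> V z, V)}\<close> with \<open>z\<close> and \<open>z \<bullet> V z\<close> fixed; along such a segment \<open>m\<^sub>0\<close> and \<open>m\<^sub>1\<close> are moment generating functions,
  hence analytic, and the equality continues to points of the surface whose mean is outside
  the cone. There the UIT statistic is strictly smaller than Hotelling's, so \<open>m\<^sub>1 \<le> c m\<^sub>0\<close> in a
  neighbourhood. But \<open>m\<^sub>1\<close> is convex in \<open>t\<close> and \<open>m\<^sub>0\<close> does not depend on \<open>t\<close>; equality at an interior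
  point of a segment through the origin forces \<open>\<theta> \<bullet> \<Sigma>\<^sup>-\<^sup>1 t = 0\<close> almost surely under the alternative prior.
  Enough directions \<open>t\<close> arise in this way to give \<open>\<theta> = 0\<close> almost surely, which is impossible.
\<close>

section \<open>Symmetric positive definite matrices\<close>

lemma spd_symmetric: "A \<in> spd_matrices \<Longrightarrow> transpose A = A"
  by (simp add: spd_matrices_def)

lemma spd_pos: "A \<in> spd_matrices \<Longrightarrow> v \<noteq> 0 \<Longrightarrow> v \<bullet> (A *v v) > 0"
  by (simp add: spd_matrices_def)

lemma spd_nonneg: "A \<in> spd_matrices \<Longrightarrow> v \<bullet> (A *v v) \<ge> 0"
  by (cases "v = 0") (auto dest: spd_pos intro: less_imp_le)

lemma symmetric_form:
  fixes A :: "real^'p^'p" shows "transpose A = A \<Longrightarrow> x \<bullet> (A *v y) = y \<bullet> (A *v x)"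
  by (metis dot_lmul_matrix inner_commute transpose_matrix_vector)

lemma spd_invertible: "A \<in> spd_matrices \<Longrightarrow> invertible A"
  unfolding invertible_left_inverse matrix_left_invertible_ker
  using spd_pos by fastforce

lemma matrix_inv_mult:
  fixes A :: "real^'p^'p"
  assumes "invertible A" shows "A ** matrix_inv A = mat 1" "matrix_inv A ** A = mat 1"
proof -
  have "\<exists>B. A ** B = mat 1 \<and> B ** A = mat 1"
    using assms unfolding invertible_def by auto
  then have "A ** matrix_inv A = mat 1 \<and> matrix_inv A ** A = mat 1"
    unfolding matrix_inv_def by (rule someI_ex)
  then show "A ** matrix_inv A = mat 1" "matrix_inv A ** A = mat 1" by auto
qed

lemma matrix_inv_cancel:
  fixes A :: "real^'p^'p"
  assumes "invertible A" shows "A *v (matrix_inv A *v x) = x" "matrix_inv A *v (A *v x) = x"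
  using matrix_inv_mult[OF assms] by (simp_all add: matrix_vector_mul_assoc)

lemma spd_matrix_inv:
  assumes A: "A \<in> spd_matrices" shows "matrix_inv A \<in> spd_matrices"
proof -
  note inv = spd_invertible[OF A]
  have "transpose (matrix_inv A) = matrix_inv A"
  proof -
    have "transpose (matrix_inv A) ** A = mat 1"
      by (metis matrix_inv_mult(1)[OF inv] matrix_transpose_mul spd_symmetric[OF A] transpose_mat)
    then show ?thesis
      by (metis matrix_inv_mult(1)[OF inv] matrix_mul_assoc matrix_mul_lid matrix_mul_rid)
  qed
  moreover have "v \<bullet> (matrix_inv A *v v) > 0" if "v \<noteq> 0" for v
  proof -
    have "matrix_inv A *v v \<noteq> 0"
      using that matrix_inv_cancel(1)[OF inv, of v] by auto
    from spd_pos[OF A this] show ?thesis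
      by (simp add: matrix_inv_cancel[OF inv] inner_commute)
  qed
  ultimately show ?thesis by (simp add: spd_matrices_def)
qed

lemma continuous_on_det:
  fixes f :: "'a::topological_space \<Rightarrow> real^'p^'p"
  assumes "\<And>i j. continuous_on S (\<lambda>x. f x $ i $ j)"
  shows "continuous_on S (\<lambda>x. det (f x))"
  unfolding det_def by (intro continuous_intros assms)

text \<open>All matrices on the segment from the identity to \<open>A\<close> are positive definite,
  hence invertible, so the determinant cannot vanish there and keeps the sign it has at the
  identity.\<close>

lemma spd_det_pos:
  assumes A: "A \<in> spd_matrices" shows "det A > 0"
proof (rule ccontr)
  assume neg: "\<not> det A > 0"
  define M where "M t = (1 - t) *\<^sub>R mat 1 + t *\<^sub>R A" for t :: real
  have "continuous_on {0..1} (\<lambda>t. det (M t))"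
    unfolding M_def by (intro continuous_on_det) (auto intro!: continuous_intros)
  moreover have "det (M 1) \<le> 0" "0 \<le> det (M 0)"
    using neg by (auto simp: M_def)
  ultimately obtain t where t: "0 \<le> t" "t \<le> 1" "det (M t) = 0"
    using IVT2'[of "\<lambda>t. det (M t)" 1 0 0] by auto
  have "M t \<in> spd_matrices"
  proof -
    have "v \<bullet> (M t *v v) > 0" if "v \<noteq> 0" for v
    proof -
      have eq: "v \<bullet> (M t *v v) = (1 - t) * (v \<bullet> v) + t * (v \<bullet> (A *v v))"
        by (simp add: M_def matrix_vector_mult_add_rdistrib scaleR_matrix_vector_assoc[symmetric] inner_add_right)
      have "v \<bullet> v > 0" "v \<bullet> (A *v v) > 0" using that spd_pos[OF A] by auto
      then show ?thesis unfolding eq using t(1,2)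
        by (cases "t = 0") (auto intro!: add_nonneg_pos mult_pos_pos)
    qed
    moreover have "transpose (M t) = M t"
      using spd_symmetric[OF A] by (auto simp: M_def transpose_def vec_eq_iff mat_def)
    ultimately show ?thesis by (simp add: spd_matrices_def)
  qed
  then show False
    using spd_invertible t(3) invertible_det_nz by blast
qed

section \<open>Inverses: determinant, entries, continuity\<close>

lemma det_matrix_inv:
  fixes A :: "real^'p^'p"
  assumes "invertible A" shows "det (matrix_inv A) = 1 / det A"
proof -
  have "det A * det (matrix_inv A) = 1"
    by (metis det_I det_mul matrix_inv_mult(1)[OF assms])
  then show ?thesis by (metis nonzero_eq_divide_eq mult.commute mult_zero_left zero_neq_one)
qed

text \<open>Cramer's rule for the column \<open>matrix_inv A *v axis j 1\<close>. It makes the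
  entries quotients of determinants, from which continuity of the inverse is read off.\<close>

lemma matrix_inv_component:
  fixes A :: "real^'p^'p"
  assumes "invertible A"
  shows "matrix_inv A $ i $ j = det (\<chi> a b. if b = i then axis j 1 $ a else A $ a $ b) / det A"
proof -
  have "A *v (matrix_inv A *v axis j 1) = axis j 1"
    by (rule matrix_inv_cancel[OF assms])
  then have "matrix_inv A *v axis j 1 = (\<chi> k. det (\<chi> a b. if b = k then axis j 1 $ a else A $ a $ b) / det A)"
    using cramer assms invertible_det_nz by blast
  then show ?thesis
    by (simp add: matrix_vector_mult_basis column_def vec_eq_iff)
qed

lemma continuous_on_matrix_inv:
  fixes f :: "'a::topological_space \<Rightarrow> real^'p^'p"
  assumes cont: "continuous_on S f" and inv: "\<And>x. x \<in> S \<Longrightarrow> invertible (f x)"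
  shows "continuous_on S (\<lambda>x. matrix_inv (f x))"
proof -
  have "continuous_on S (\<lambda>x. (\<chi> i j. det (\<chi> a b. if b = i then axis j 1 $ a else f x $ a $ b) / det (f x)))"
  proof (intro continuous_on_vec_lambda continuous_on_divide continuous_on_det)
    fix i j a b
    show "continuous_on S (\<lambda>x. f x $ a $ b)" by (intro continuous_intros cont)
    show "continuous_on S (\<lambda>x. (\<chi> a b. if b = i then axis j 1 $ a else f x $ a $ b) $ a $ b)"
      by (cases "b = i") (auto intro!: continuous_intros cont)
  qed (use inv invertible_det_nz in blast)
  then show ?thesis
    by (rule continuous_on_eq) (simp add: vec_eq_iff matrix_inv_component inv)
qed

lemma continuous_on_matrix_vector_mult [continuous_intros]:
  fixes f :: "'a::topological_space \<Rightarrow> real^'n^'m"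
  assumes "continuous_on S f" "continuous_on S g"
  shows "continuous_on S (\<lambda>x. f x *v g x)"
  unfolding matrix_vector_mult_def by (intro continuous_intros assms)

section \<open>Entries and determinant bounded by the trace\<close>

lemma form_axis: "axis i 1 \<bullet> (A *v axis j 1) = (A :: real^'n^'m) $ i $ j"
  by (simp add: matrix_vector_mult_basis column_def inner_axis')

lemma spd_diag_nonneg: "A \<in> spd_matrices \<Longrightarrow> A $ i $ i \<ge> 0"
  using spd_nonneg[of A "axis i 1"] by (simp add: form_axis)

lemma spd_diag_le_trace: "A \<in> spd_matrices \<Longrightarrow> A $ i $ i \<le> trace A"
  unfolding trace_def by (rule member_le_sum) (auto intro: spd_diag_nonneg)

lemma spd_trace_nonneg: "A \<in> spd_matrices \<Longrightarrow> 0 \<le> trace A"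
  unfolding trace_def by (intro sum_nonneg spd_diag_nonneg)

text \<open>Testing the form on \<open>axis i 1 + axis j 1\<close> and
  \<open>axis i 1 - axis j 1\<close> bounds twice the absolute entry by
  \<open>A $ i $ i + A $ j $ j\<close>.\<close>

lemma spd_component_le_trace:
  assumes A: "A \<in> spd_matrices" shows "\<bar>A $ i $ j\<bar> \<le> trace A"
proof -
  have sym: "A $ j $ i = A $ i $ j"
    using spd_symmetric[OF A] by (metis transpose_def vec_lambda_beta)
  have "0 \<le> (axis i 1 + axis j 1) \<bullet> (A *v (axis i 1 + axis j 1))"
       "0 \<le> (axis i 1 - axis j 1) \<bullet> (A *v (axis i 1 - axis j 1))"
    using spd_nonneg[OF A] by blast+
  then have "0 \<le> A$i$i + A$j$j + 2 * A$i$j" "0 \<le> A$i$i + A$j$j - 2 * A$i$j"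
    using sym by (simp_all add: inner_add_left inner_add_right inner_diff_left inner_diff_right
        matrix_vector_right_distrib matrix_vector_mult_diff_distrib form_axis)
  with spd_diag_le_trace[OF A, of i] spd_diag_le_trace[OF A, of j] show ?thesis by linarith
qed

text \<open>Crude Leibniz bound with \<open>fact CARD('p)\<close> products of entries. Applied to
  the precision matrix, it makes the normalizing factor of the density at most polynomial in the
  trace.\<close>

lemma spd_det_le:
  fixes A :: "real^'p^'p"
  assumes A: "A \<in> spd_matrices"
  shows "det A \<le> fact CARD('p) * trace A ^ CARD('p)"
proof -
  have "det A \<le> (\<Sum>\<pi>\<in>{\<pi>. \<pi> permutes (UNIV::'p set)}. \<bar>of_int (sign \<pi>) * (\<Prod>i\<in>UNIV. A $ i $ \<pi> i)\<bar>)"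
    unfolding det_def by (intro sum_mono) simp
  also have "\<dots> \<le> (\<Sum>\<pi>\<in>{\<pi>. \<pi> permutes (UNIV::'p set)}. trace A ^ CARD('p))"
  proof (intro sum_mono)
    fix \<pi> :: "'p \<Rightarrow> 'p"
    have "\<bar>of_int (sign \<pi>) * (\<Prod>i\<in>UNIV. A $ i $ \<pi> i)\<bar> = (\<Prod>i\<in>UNIV. \<bar>A $ i $ \<pi> i\<bar>)"
      by (simp add: abs_mult abs_prod sign_def)
    also have "\<dots> \<le> (\<Prod>i\<in>(UNIV::'p set). trace A)"
      by (intro prod_mono) (auto intro: spd_component_le_trace[OF A])
    finally show "\<bar>of_int (sign \<pi>) * (\<Prod>i\<in>UNIV. A $ i $ \<pi> i)\<bar> \<le> trace A ^ CARD('p)" by simp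
  qed
  also have "\<dots> = fact CARD('p) * trace A ^ CARD('p)"
    by (simp add: card_permutations)
  finally show ?thesis .
qed

section \<open>Projections and the union-intersection statistic\<close>

lemma inner_wrt_commute:
  assumes "A \<in> spd_matrices" shows "inner_wrt A x y = inner_wrt A y x"
  unfolding inner_wrt_def by (rule symmetric_form[OF spd_symmetric[OF spd_matrix_inv[OF assms]]])

lemma inner_wrt_nonneg: "A \<in> spd_matrices \<Longrightarrow> 0 \<le> inner_wrt A x x"
  unfolding inner_wrt_def by (intro spd_nonneg spd_matrix_inv)

lemma inner_wrt_pos: "A \<in> spd_matrices \<Longrightarrow> x \<noteq> 0 \<Longrightarrow> 0 < inner_wrt A x x"
  unfolding inner_wrt_def by (intro spd_pos spd_matrix_inv)

lemma norm_wrt_sq: "A \<in> spd_matrices \<Longrightarrow> (norm_wrt A x)\<^sup>2 = inner_wrt A x x"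
  by (simp add: norm_wrt_def inner_wrt_nonneg)

lemma inner_wrt_diff_scale:
  assumes "A \<in> spd_matrices"
  shows "inner_wrt A (x - t *\<^sub>R y) (x - t *\<^sub>R y)
    = inner_wrt A x x - 2 * t * inner_wrt A x y + t\<^sup>2 * inner_wrt A y y"
  using inner_wrt_commute[OF assms, of y x]
  by (simp add: inner_wrt_def matrix_vector_mult_diff_distrib matrix_vector_mult_scaleR
      inner_diff_left inner_diff_right algebra_simps power2_eq_square)

lemma spd_cauchy_schwarz:
  assumes A: "A \<in> spd_matrices"
  shows "(x \<bullet> (A *v y))\<^sup>2 \<le> (x \<bullet> (A *v x)) * (y \<bullet> (A *v y))"
proof (cases "y = 0")
  case False
  define a where "a = x \<bullet> (A *v y)"
  define b where "b = y \<bullet> (A *v y)"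
  have b: "b > 0" unfolding b_def by (rule spd_pos[OF A False])
  have "0 \<le> (x - (a / b) *\<^sub>R y) \<bullet> (A *v (x - (a / b) *\<^sub>R y))"
    by (rule spd_nonneg[OF A])
  also have "\<dots> = x \<bullet> (A *v x) - 2 * (a / b) * a + (a / b)\<^sup>2 * b"
    using symmetric_form[OF spd_symmetric[OF A], of y x]
    by (simp add: a_def b_def matrix_vector_mult_diff_distrib matrix_vector_mult_scaleR
        inner_diff_left inner_diff_right algebra_simps power2_eq_square)
  also have "\<dots> = x \<bullet> (A *v x) - a\<^sup>2 / b"
    using b by (simp add: field_simps power2_eq_square)
  finally show ?thesis
    using b by (simp add: a_def[symmetric] b_def[symmetric] field_simps)
qed simp

text \<open>The form attains a positive minimum on the unit sphere by compactness; homogeneity does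
  the rest.\<close>

lemma spd_coercive:
  fixes A :: "real^'p^'p"
  assumes A: "A \<in> spd_matrices"
  obtains \<kappa> where "\<kappa> > 0" "\<And>v. \<kappa> * (norm v)\<^sup>2 \<le> v \<bullet> (A *v v)"
proof -
  have "compact (sphere (0::real^'p) 1)" "sphere (0::real^'p) 1 \<noteq> {}" by auto
  moreover have "continuous_on (sphere 0 1) (\<lambda>v. v \<bullet> (A *v v))"
    by (intro continuous_intros)
  ultimately obtain w where w: "w \<in> sphere 0 1" "\<And>v. v \<in> sphere 0 1 \<Longrightarrow> w \<bullet> (A *v w) \<le> v \<bullet> (A *v v)"
    by (meson continuous_attains_inf)
  show thesis
  proof (rule that)
    have "w \<noteq> 0" using w(1) by auto
    then show "w \<bullet> (A *v w) > 0" by (rule spd_pos[OF A])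
    fix v :: "real^'p"
    show "w \<bullet> (A *v w) * (norm v)\<^sup>2 \<le> v \<bullet> (A *v v)"
    proof (cases "v = 0")
      case False
      have "w \<bullet> (A *v w) \<le> (v /\<^sub>R norm v) \<bullet> (A *v (v /\<^sub>R norm v))"
        using False by (intro w(2)) auto
      also have "\<dots> = (v \<bullet> (A *v v)) / (norm v)\<^sup>2"
        by (simp add: matrix_vector_mult_scaleR power2_eq_square field_simps)
      finally show ?thesis using False by (simp add: field_simps)
    qed simp
  qed
qed

text \<open>Coercivity makes every point outside a ball worse than a fixed point \<open>z\<close> of
  \<open>C\<close>, so the minimum over the compact part of \<open>C\<close> inside the ball is
  global, and \<open>arg_min_on\<close> returns a minimizer.\<close>

lemma proj_wrt_minimal:
  fixes A :: "real^'p^'p"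
  assumes A: "A \<in> spd_matrices" and C: "closed C" "C \<noteq> {}"
  shows "proj_wrt A x C \<in> C"
    and "y \<in> C \<Longrightarrow> inner_wrt A (x - proj_wrt A x C) (x - proj_wrt A x C) \<le> inner_wrt A (x - y) (x - y)"
proof -
  define q where "q y = inner_wrt A (x - y) (x - y)" for y
  obtain \<kappa> where \<kappa>: "\<kappa> > 0" "\<And>v. \<kappa> * (norm v)\<^sup>2 \<le> v \<bullet> (matrix_inv A *v v)"
    using spd_coercive[OF spd_matrix_inv[OF A]] by blast
  obtain z where z: "z \<in> C" using C by auto
  \<comment> \<open>The radius at which the coercive lower bound for \<open>q\<close> reaches
    \<open>q z\<close>.\<close>
  define r where "r = sqrt (q z / \<kappa>)"
  have qz: "q z \<ge> 0" unfolding q_def by (rule inner_wrt_nonneg[OF A])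
  have far: "q z < q y" if "y \<notin> cball x r" for y
  proof -
    have "r < norm (x - y)" using that by (simp add: dist_norm)
    then have "r\<^sup>2 < (norm (x - y))\<^sup>2" using qz \<kappa>(1) by (intro power_strict_mono) (auto simp: r_def)
    then have "q z < \<kappa> * (norm (x - y))\<^sup>2" using qz \<kappa>(1) by (simp add: r_def field_simps)
    also have "\<dots> \<le> q y" using \<kappa>(2)[of "x - y"] by (simp add: q_def inner_wrt_def)
    finally show ?thesis .
  qed
  have "compact (C \<inter> cball x r)" using C(1) by (simp add: closed_Int_compact)
  moreover have "C \<inter> cball x r \<noteq> {}" using z far[of z] by (metis IntI empty_iff less_irrefl)
  moreover have "continuous_on (C \<inter> cball x r) q"
    unfolding q_def inner_wrt_def by (intro continuous_intros)
  ultimately obtain m where m: "m \<in> C \<inter> cball x r" "\<And>y. y \<in> C \<inter> cball x r \<Longrightarrow> q m \<le> q y"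
    by (meson continuous_attains_inf)
  have min: "q m \<le> q y" if "y \<in> C" for y
  proof (cases "y \<in> cball x r")
    case False
    have "q m \<le> q z" using m(2)[of z] z far[of z] by auto
    with far[OF False] show ?thesis by simp
  qed (use m that in auto)
  have *: "norm_wrt A (x - y) \<le> norm_wrt A (x - y') \<longleftrightarrow> q y \<le> q y'" for y y'
    by (simp add: norm_wrt_def q_def)
  have "proj_wrt A x C \<in> C \<and> (\<forall>y\<in>C. q (proj_wrt A x C) \<le> q y)"
    unfolding proj_wrt_def arg_min_on_def
  proof (rule arg_minI[of _ m])
    show "m \<in> C" using m by auto
  qed (use min in \<open>auto simp: not_less *\<close>)
  then show "proj_wrt A x C \<in> C"
    and "y \<in> C \<Longrightarrow> inner_wrt A (x - proj_wrt A x C) (x - proj_wrt A x C) \<le> inner_wrt A (x - y) (x - y)"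
    by (auto simp: q_def)
qed

text \<open>\<open>C\<close> contains the ray through the projection \<open>y\<close>, and
  minimality along this ray forces the inner products of \<open>x\<close> and of \<open>y\<close>
  with \<open>y\<close> to agree. The identity is then Pythagoras.\<close>

lemma inner_wrt_proj_cone:
  fixes A :: "real^'p^'p"
  assumes A: "A \<in> spd_matrices" and C: "closed C" "C \<noteq> {}"
    and cone: "\<And>t y. 0 \<le> t \<Longrightarrow> y \<in> C \<Longrightarrow> t *\<^sub>R y \<in> C"
  shows "inner_wrt A (proj_wrt A x C) (proj_wrt A x C)
    = inner_wrt A x x - inner_wrt A (x - proj_wrt A x C) (x - proj_wrt A x C)"
proof -
  define y where "y = proj_wrt A x C"
  define b where "b = inner_wrt A x y"
  define c where "c = inner_wrt A y y"
  have y: "y \<in> C" unfolding y_def by (rule proj_wrt_minimal[OF A C])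
  have min: "- 2 * b + c \<le> - 2 * t * b + t\<^sup>2 * c" if "t \<ge> 0" for t
    using proj_wrt_minimal(2)[OF A C cone[OF that y], of x]
      inner_wrt_diff_scale[OF A, of x t y] inner_wrt_diff_scale[OF A, of x 1 y]
    by (simp add: y_def[symmetric] b_def c_def)
  have "b = c"
  proof (cases "y = 0")
    case False
    then have c: "c > 0" unfolding c_def by (rule inner_wrt_pos[OF A])
    have b: "b \<ge> 0" using min[of 0] c by simp
    \<comment> \<open>\<open>b / c\<close> minimizes the quadratic in \<open>t\<close>.\<close>
    have "- 2 * b + c \<le> - 2 * (b / c) * b + (b / c)\<^sup>2 * c" using b c by (intro min) simp
    also have "\<dots> = - b\<^sup>2 / c" using c by (simp add: field_simps power2_eq_square)
    finally have "(- 2 * b + c) * c \<le> - b\<^sup>2" using c by (simp add: field_simps)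
    then have "(b - c)\<^sup>2 \<le> 0" by (simp add: power2_eq_square algebra_simps)
    then show ?thesis by simp
  qed (simp add: b_def c_def inner_wrt_def)
  then show ?thesis
    using inner_wrt_diff_scale[OF A, of x 1 y] by (simp add: y_def[symmetric] b_def c_def)
qed

section \<open>Comparison of the union-intersection statistic with Hotelling's\<close>

definition hotelling :: "real^'p^'n \<Rightarrow> real" where
  "hotelling x = real CARD('n) * inner_wrt (sample_cov x) (sample_mean x) (sample_mean x)"

lemma inner_wrt_scale: "inner_wrt A (t *\<^sub>R x) (t *\<^sub>R x) = t\<^sup>2 * inner_wrt A x x"
  by (simp add: inner_wrt_def matrix_vector_mult_scaleR power2_eq_square)

text \<open>The difference of the two statistics is the squared distance from \<open>z\<close> to
  the cone. It is nonnegative, vanishes when the mean lies in the cone, and is bounded below by the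
  distance to any half-space \<open>0 \<le> y $ l\<close> that contains the cone.\<close>

lemma
  fixes x :: "real^'p^'n"
  assumes S: "sample_cov x \<in> spd_matrices" and C: "closed C" "C \<noteq> {}"
    and cone: "\<And>t y. 0 \<le> t \<Longrightarrow> y \<in> C \<Longrightarrow> t *\<^sub>R y \<in> C"
  shows uit_stat_le_hotelling: "uit_stat C x \<le> hotelling x"
    and uit_stat_eq_hotelling: "sample_mean x \<in> C \<Longrightarrow> uit_stat C x = hotelling x"
    and uit_stat_le_half_space: "(\<And>y. y \<in> C \<Longrightarrow> 0 \<le> y $ l) \<Longrightarrow> sample_mean x $ l < 0 \<Longrightarrow>
      uit_stat C x \<le> hotelling x - real CARD('n) * (sample_mean x $ l)\<^sup>2 / sample_cov x $ l $ l"
proof -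
  define A where "A = sample_cov x"
  define z where "z = sqrt (real CARD('n)) *\<^sub>R sample_mean x"
  define y where "y = proj_wrt A z C"
  note A = S[folded A_def]
  have z: "inner_wrt A z z = hotelling x"
    by (simp add: z_def A_def hotelling_def inner_wrt_scale)
  have U: "uit_stat C x = hotelling x - inner_wrt A (z - y) (z - y)"
    using inner_wrt_proj_cone[OF A C cone, of z] S
    by (simp add: uit_stat_def A_def[symmetric] z_def[symmetric] norm_wrt_sq z y_def)
  show "uit_stat C x \<le> hotelling x"
    unfolding U using inner_wrt_nonneg[OF A] by simp
  show "uit_stat C x = hotelling x" if "sample_mean x \<in> C"
  proof -
    have "z \<in> C" unfolding z_def by (intro cone that) simp
    from proj_wrt_minimal(2)[OF A C this, of z] have "inner_wrt A (z - y) (z - y) \<le> 0"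
      by (simp add: y_def[symmetric] inner_wrt_def)
    with inner_wrt_nonneg[OF A, of "z - y"] show ?thesis unfolding U by simp
  qed
  show "uit_stat C x \<le> hotelling x - real CARD('n) * (sample_mean x $ l)\<^sup>2 / sample_cov x $ l $ l"
    if Cl: "\<And>y. y \<in> C \<Longrightarrow> 0 \<le> y $ l" and neg: "sample_mean x $ l < 0"
  proof -
    define v where "v = z - y"
    have "y \<in> C" unfolding y_def by (rule proj_wrt_minimal[OF A C])
    then have "0 \<le> y $ l" by (rule Cl)
    moreover have zl: "z $ l < 0" using neg by (simp add: z_def mult_pos_neg)
    ultimately have "v $ l \<le> z $ l" "z $ l < 0" by (auto simp: v_def)
    then have "(z $ l)\<^sup>2 \<le> (v $ l)\<^sup>2" by (simp add: abs_le_square_iff[symmetric])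
    \<comment> \<open>In this form Cauchy-Schwarz for \<open>A\<close> compares a Euclidean
      coordinate with the norm given by the inverse of \<open>A\<close>.\<close>
    also have "v $ l = axis l 1 \<bullet> (A *v (matrix_inv A *v v))"
      by (simp add: matrix_inv_cancel[OF spd_invertible[OF A]] inner_axis')
    also have "\<dots>\<^sup>2 \<le> A $ l $ l * inner_wrt A v v"
      using spd_cauchy_schwarz[OF A, of "axis l 1" "matrix_inv A *v v"]
      by (simp add: form_axis matrix_inv_cancel[OF spd_invertible[OF A]] inner_wrt_def inner_commute)
    finally have le: "(z $ l)\<^sup>2 \<le> A $ l $ l * inner_wrt A v v" .
    have "A $ l $ l > 0" using spd_pos[OF A, of "axis l 1"] by (simp add: form_axis)
    with le have "(z $ l)\<^sup>2 / A $ l $ l \<le> inner_wrt A v v"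
      by (simp add: field_simps)
    moreover have "(z $ l)\<^sup>2 = real CARD('n) * (sample_mean x $ l)\<^sup>2"
      by (simp add: z_def power_mult_distrib)
    ultimately show ?thesis unfolding U v_def A_def by simp
  qed
qed

section \<open>Regular samples\<close>

lemma form_eq_sum: "v \<bullet> (A *v w) = (\<Sum>a\<in>UNIV. \<Sum>b\<in>UNIV. A $ a $ b * (v $ a * w $ b))"
  for A :: "real^'n^'m"
  by (simp add: inner_vec_def matrix_vector_mult_def sum_distrib_left mult_ac)

lemma sample_cov_component:
  fixes x :: "real^'p^'n"
  shows "sample_cov x $ a $ b = (\<Sum>i\<in>UNIV. (x $ i - sample_mean x) $ a * (x $ i - sample_mean x) $ b) / (real CARD('n) - 1)"
  by (simp add: sample_cov_def)

text \<open>The double sum is the trace of \<open>P ** sample_cov x\<close>: the forms at the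
  deviations depend on the sample through its covariance only.\<close>

lemma sum_form_deviation:
  fixes x :: "real^'p^'n" and P :: "real^'p^'p"
  assumes n: "CARD('n) > 1"
  shows "(\<Sum>i\<in>UNIV. (x $ i - sample_mean x) \<bullet> (P *v (x $ i - sample_mean x)))
    = (real CARD('n) - 1) * (\<Sum>a\<in>UNIV. \<Sum>b\<in>UNIV. P $ a $ b * sample_cov x $ a $ b)"
proof -
  have "(\<Sum>i\<in>UNIV. (x $ i - sample_mean x) \<bullet> (P *v (x $ i - sample_mean x)))
    = (\<Sum>a\<in>UNIV. \<Sum>b\<in>UNIV. P $ a $ b * (\<Sum>i\<in>UNIV. (x $ i - sample_mean x) $ a * (x $ i - sample_mean x) $ b))"
    unfolding form_eq_sum sum_distrib_left
    by (subst sum.swap, rule sum.cong[OF refl], subst sum.swap) simp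
  also have "\<dots> = (real CARD('n) - 1) * (\<Sum>a\<in>UNIV. \<Sum>b\<in>UNIV. P $ a $ b * sample_cov x $ a $ b)"
    using n by (simp add: sample_cov_component sum_distrib_left sum_divide_distrib)
  finally show ?thesis .
qed

text \<open>Exhibits the range of the covariance inside the span of the deviations; for a regular
  sample every coordinate vector is therefore a combination of them.\<close>

lemma sample_cov_mult:
  fixes x :: "real^'p^'n"
  shows "sample_cov x *v v = (1 / (real CARD('n) - 1)) *\<^sub>R
    (\<Sum>i\<in>UNIV. ((x $ i - sample_mean x) \<bullet> v) *\<^sub>R (x $ i - sample_mean x))"
proof -
  have "(sample_cov x *v v) $ a = ((1 / (real CARD('n) - 1)) *\<^sub>R
    (\<Sum>i\<in>UNIV. ((x $ i - sample_mean x) \<bullet> v) *\<^sub>R (x $ i - sample_mean x))) $ a" for a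
    unfolding matrix_vector_mult_def inner_vec_def
    by (simp add: sample_cov_component sum_distrib_left sum_distrib_right sum_divide_distrib mult_ac)
       (subst sum.swap, simp add: mult_ac)
  then show ?thesis by (simp add: vec_eq_iff)
qed

lemma transpose_sample_cov: "transpose (sample_cov x) = sample_cov x"
  by (simp add: transpose_def vec_eq_iff sample_cov_component mult.commute)

lemma continuous_on_sample_mean [continuous_intros]: "continuous_on S (sample_mean :: real^'p^'n \<Rightarrow> _)"
  unfolding sample_mean_def[abs_def] by (intro continuous_intros)

lemma continuous_on_sample_cov [continuous_intros]: "continuous_on S (sample_cov :: real^'p^'n \<Rightarrow> _)"
  unfolding sample_cov_def[abs_def] by (intro continuous_intros)

text \<open>If the entries change in total by less than the coercivity constant of \<open>A\<close>,
  the form at \<open>v\<close> changes by less than its lower bound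
  \<open>\<kappa> * (norm v)\<^sup>2\<close>.\<close>

lemma spd_perturbation:
  fixes A :: "real^'p^'p"
  assumes A: "A \<in> spd_matrices"
  obtains \<epsilon> where "\<epsilon> > 0"
    "\<And>B. transpose B = B \<Longrightarrow> (\<Sum>a\<in>UNIV. \<Sum>b\<in>UNIV. \<bar>B $ a $ b - A $ a $ b\<bar>) < \<epsilon> \<Longrightarrow> B \<in> spd_matrices"
proof -
  obtain \<kappa> where \<kappa>: "\<kappa> > 0" "\<And>v. \<kappa> * (norm v)\<^sup>2 \<le> v \<bullet> (A *v v)"
    using spd_coercive[OF A] by blast
  show thesis
  proof (rule that[OF \<kappa>(1)])
    fix B :: "real^'p^'p"
    assume sym: "transpose B = B" and less: "(\<Sum>a\<in>UNIV. \<Sum>b\<in>UNIV. \<bar>B $ a $ b - A $ a $ b\<bar>) < \<kappa>"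
    have "v \<bullet> (B *v v) > 0" if "v \<noteq> 0" for v
    proof -
      have "v \<bullet> (A *v v) - v \<bullet> (B *v v)
        = (\<Sum>a\<in>UNIV. \<Sum>b\<in>UNIV. (A $ a $ b - B $ a $ b) * (v $ a * v $ b))"
        by (simp add: form_eq_sum sum_subtractf[symmetric] left_diff_distrib)
      also have "\<dots> \<le> (\<Sum>a\<in>UNIV. \<Sum>b\<in>UNIV. \<bar>B $ a $ b - A $ a $ b\<bar> * (norm v)\<^sup>2)"
      proof (intro sum_mono)
        fix a b
        have "\<bar>v $ a\<bar> * \<bar>v $ b\<bar> \<le> norm v * norm v"
          by (intro mult_mono component_le_norm_cart) auto
        then have "\<bar>A $ a $ b - B $ a $ b\<bar> * \<bar>v $ a * v $ b\<bar> \<le> \<bar>A $ a $ b - B $ a $ b\<bar> * (norm v)\<^sup>2"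
          by (intro mult_left_mono) (auto simp: abs_mult power2_eq_square)
        then have "\<bar>(A $ a $ b - B $ a $ b) * (v $ a * v $ b)\<bar> \<le> \<bar>A $ a $ b - B $ a $ b\<bar> * (norm v)\<^sup>2"
          by (simp add: abs_mult)
        then show "(A $ a $ b - B $ a $ b) * (v $ a * v $ b) \<le> \<bar>B $ a $ b - A $ a $ b\<bar> * (norm v)\<^sup>2"
          by (simp add: abs_minus_commute)
      qed
      also have "\<dots> = (\<Sum>a\<in>UNIV. \<Sum>b\<in>UNIV. \<bar>B $ a $ b - A $ a $ b\<bar>) * (norm v)\<^sup>2"
        by (simp add: sum_distrib_right)
      also have "\<dots> < \<kappa> * (norm v)\<^sup>2" using less that by simp
      finally show ?thesis using \<kappa>(2)[of v] by simp
    qed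
    with sym show "B \<in> spd_matrices" by (simp add: spd_matrices_def)
  qed
qed

lemma eventually_sample_cov_close:
  fixes x0 :: "real^'p^'n"
  assumes "\<epsilon> > 0"
  shows "\<forall>\<^sub>F x in nhds x0. (\<Sum>a\<in>UNIV. \<Sum>b\<in>UNIV. \<bar>sample_cov x $ a $ b - sample_cov x0 $ a $ b\<bar>) < \<epsilon>"
proof -
  have "continuous_on UNIV (\<lambda>x. \<Sum>a\<in>UNIV. \<Sum>b\<in>UNIV. \<bar>sample_cov x $ a $ b - sample_cov x0 $ a $ b\<bar>)"
    by (intro continuous_intros)
  then have "open {x. (\<Sum>a\<in>UNIV. \<Sum>b\<in>UNIV. \<bar>sample_cov x $ a $ b - sample_cov x0 $ a $ b\<bar>) < \<epsilon>}"
    by (intro open_Collect_less continuous_on_const)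
  then show ?thesis unfolding eventually_nhds using assms by auto
qed

definition regular_samples :: "(real^'p^'n) set" where
  "regular_samples = {x. sample_cov x \<in> spd_matrices}"

lemma open_regular_samples: "open (regular_samples :: (real^'p^'n) set)"
proof -
  have "\<forall>\<^sub>F x in nhds x0. x \<in> regular_samples" if "x0 \<in> regular_samples" for x0 :: "real^'p^'n"
  proof -
    obtain \<epsilon> where \<epsilon>: "\<epsilon> > 0"
      "\<And>B. transpose B = B \<Longrightarrow> (\<Sum>a\<in>UNIV. \<Sum>b\<in>UNIV. \<bar>B $ a $ b - sample_cov x0 $ a $ b\<bar>) < \<epsilon> \<Longrightarrow> B \<in> spd_matrices"
      using spd_perturbation \<open>x0 \<in> regular_samples\<close> unfolding regular_samples_def by blast
    show ?thesis
      using eventually_sample_cov_close[OF \<epsilon>(1), of x0]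
      by eventually_elim (use \<epsilon>(2) transpose_sample_cov in \<open>auto simp: regular_samples_def\<close>)
  qed
  then show ?thesis by (metis (mono_tags, lifting) eventually_nhds open_subopen subsetI)
qed

text \<open>The deviations of a regular sample span the space, so the forms at the deviations
  control every diagonal entry of \<open>P\<close>, with a constant independent of \<open>P\<close>.
  This yields decay of the density in the trace of the precision matrix.\<close>

lemma trace_le_sum_form_deviation:
  fixes x :: "real^'p^'n"
  assumes x: "x \<in> regular_samples" and n: "CARD('n) > 1"
  obtains \<beta> where "\<beta> > 0"
    "\<And>P. P \<in> spd_matrices \<Longrightarrow> \<beta> * trace P \<le> (\<Sum>a\<in>UNIV. \<Sum>b\<in>UNIV. P $ a $ b * sample_cov x $ a $ b)"
proof -
  define d where "d i = x $ i - sample_mean x" for i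
  define S where "S = sample_cov x"
  \<comment> \<open>Coefficients of \<open>axis k 1\<close> in the deviations, read off from
    \<open>S *v (matrix_inv S *v axis k 1)\<close>.\<close>
  define c where "c k i = d i \<bullet> (matrix_inv S *v axis k 1) / (real CARD('n) - 1)" for k :: 'p and i
  define K where "K = 1 + (\<Sum>k\<in>UNIV. \<Sum>i\<in>UNIV. (c k i)\<^sup>2)"
  have S: "S \<in> spd_matrices" using x by (simp add: regular_samples_def S_def)
  have K: "K > 0" unfolding K_def by (intro add_pos_nonneg sum_nonneg) auto
  have axis_eq: "axis k 1 = (\<Sum>i\<in>UNIV. c k i *\<^sub>R d i)" for k
  proof -
    have "axis k 1 = S *v (matrix_inv S *v axis k 1)"
      by (simp add: matrix_inv_cancel[OF spd_invertible[OF S]])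
    then show ?thesis
      by (simp add: S_def sample_cov_mult d_def c_def scaleR_sum_right mult.commute)
  qed
  show thesis
  proof (rule that)
    show "0 < 1 / (K * (real CARD('n) - 1))" using K n by simp
    fix P :: "real^'p^'p" assume P: "P \<in> spd_matrices"
    define T where "T = (\<Sum>i\<in>UNIV. d i \<bullet> (P *v d i))"
    have T: "T \<ge> 0" unfolding T_def by (intro sum_nonneg spd_nonneg P)
    have "P $ k $ k \<le> (\<Sum>i\<in>UNIV. (c k i)\<^sup>2) * T" for k
    proof -
      have Pk: "P $ k $ k > 0" using spd_pos[OF P, of "axis k 1"] by (simp add: form_axis)
      have "P $ k $ k = (\<Sum>i\<in>UNIV. c k i * (d i \<bullet> (P *v axis k 1)))"
        unfolding form_axis[symmetric, of P k k] by (subst (1) axis_eq) (simp add: inner_sum_left)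
      \<comment> \<open>Cauchy-Schwarz is used twice, for the sum over \<open>i\<close> and then for
        the form \<open>P\<close>; one factor \<open>P $ k $ k\<close> cancels at the end.\<close>
      then have "(P $ k $ k)\<^sup>2 \<le> (\<Sum>i\<in>UNIV. (c k i)\<^sup>2) * (\<Sum>i\<in>UNIV. (d i \<bullet> (P *v axis k 1))\<^sup>2)"
        by (simp only: Cauchy_Schwarz_ineq_sum)
      also have "\<dots> \<le> (\<Sum>i\<in>UNIV. (c k i)\<^sup>2) * (\<Sum>i\<in>UNIV. (d i \<bullet> (P *v d i)) * P $ k $ k)"
        using spd_cauchy_schwarz[OF P, of _ "axis k 1"]
        by (intro mult_left_mono sum_mono sum_nonneg) (auto simp: form_axis)
      also have "\<dots> = ((\<Sum>i\<in>UNIV. (c k i)\<^sup>2) * T) * P $ k $ k"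
        by (simp only: T_def sum_distrib_right[symmetric] mult.assoc)
      finally show ?thesis using Pk by (simp add: power2_eq_square)
    qed
    then have "trace P \<le> (\<Sum>k\<in>UNIV. (\<Sum>i\<in>UNIV. (c k i)\<^sup>2) * T)"
      unfolding trace_def by (intro sum_mono) auto
    also have "\<dots> \<le> K * T" using T by (simp add: K_def sum_distrib_right[symmetric] distrib_right)
    also have "T = (real CARD('n) - 1) * (\<Sum>a\<in>UNIV. \<Sum>b\<in>UNIV. P $ a $ b * sample_cov x $ a $ b)"
      unfolding T_def d_def by (rule sum_form_deviation[OF n])
    finally have "trace P \<le> K * ((real CARD('n) - 1) * (\<Sum>a\<in>UNIV. \<Sum>b\<in>UNIV. P $ a $ b * sample_cov x $ a $ b))" .
    then show "1 / (K * (real CARD('n) - 1)) * trace P \<le> (\<Sum>a\<in>UNIV. \<Sum>b\<in>UNIV. P $ a $ b * sample_cov x $ a $ b)"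
      using K n by (simp add: field_simps)
  qed
qed

section \<open>Marginal densities\<close>

lemma joint_density_eq:
  fixes x :: "real^'p^'n"
  shows "joint_density x \<theta> \<Sigma> =
    exp (- (\<Sum>i\<in>UNIV. (x $ i - \<theta>) \<bullet> (matrix_inv \<Sigma> *v (x $ i - \<theta>))) / 2)
      / sqrt ((2 * pi) ^ CARD('p) * det \<Sigma>) ^ CARD('n)"
  by (simp add: joint_density_def mvn_density_def prod_dividef exp_sum[symmetric] sum_negf[symmetric] sum_divide_distrib)

lemma joint_density_pos: "\<Sigma> \<in> spd_matrices \<Longrightarrow> 0 < joint_density x \<theta> \<Sigma>"
  by (simp add: joint_density_eq spd_det_pos)

text \<open>The deviations sum to zero, so the cross term drops and the mean is the best centre.
  Bounds obtained for the deviations thereby become uniform in \<open>\<theta>\<close>.\<close>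

lemma sum_form_deviation_le:
  fixes x :: "real^'p^'n"
  assumes P: "P \<in> spd_matrices"
  shows "(\<Sum>i\<in>UNIV. (x $ i - sample_mean x) \<bullet> (P *v (x $ i - sample_mean x)))
    \<le> (\<Sum>i\<in>UNIV. (x $ i - \<theta>) \<bullet> (P *v (x $ i - \<theta>)))"
proof -
  define m where "m = sample_mean x - \<theta>"
  define d where "d i = x $ i - sample_mean x" for i
  have sum_d: "(\<Sum>i\<in>UNIV. d i) = 0"
    by (simp add: d_def sum_subtractf sample_mean_def sum_constant_scaleR del: sum_constant)
  have "(x $ i - \<theta>) \<bullet> (P *v (x $ i - \<theta>)) = d i \<bullet> (P *v d i) + 2 * (d i \<bullet> (P *v m)) + m \<bullet> (P *v m)" for i
  proof -
    have "x $ i - \<theta> = d i + m" by (simp add: d_def m_def)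
    then show ?thesis
      using symmetric_form[OF spd_symmetric[OF P], of m "d i"]
      by (simp add: inner_add_left inner_add_right matrix_vector_right_distrib)
  qed
  then have "(\<Sum>i\<in>UNIV. (x $ i - \<theta>) \<bullet> (P *v (x $ i - \<theta>)))
    = (\<Sum>i\<in>UNIV. d i \<bullet> (P *v d i)) + 2 * ((\<Sum>i\<in>UNIV. d i) \<bullet> (P *v m)) + (\<Sum>i\<in>(UNIV::'n set). m \<bullet> (P *v m))"
    by (simp add: sum.distrib sum_distrib_left inner_sum_left)
  then show ?thesis
    using spd_nonneg[OF P, of m] unfolding sum_d by (simp add: d_def)
qed

text \<open>From \<open>(1 + x / k) ^ k \<le> exp x\<close>; for \<open>k = 0\<close> the constant
  is \<open>0 ^ 0 = 1\<close>.\<close>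

lemma power_le_exp:
  fixes x :: real assumes "0 \<le> x" shows "x ^ k \<le> real k ^ k * exp x"
proof (cases "k = 0")
  case False
  have "(x / real k) ^ k \<le> (1 + x / real k) ^ k"
    using assms by (intro power_mono) auto
  also have "\<dots> \<le> exp x"
    using False assms by (intro exp_ge_one_plus_x_over_n_power_n) auto
  finally show ?thesis using False by (simp add: power_divide field_simps)
qed (use assms in simp)

lemma poly_exp_bounded:
  fixes a b :: real
  assumes "a \<ge> 0" "b > 0"
  obtains K where "\<And>x. 0 \<le> x \<Longrightarrow> (1 + a * x ^ p) ^ n * exp (- (b * x)) \<le> K"
proof -
  \<comment> \<open>Of the \<open>n + 1\<close> equal shares of \<open>b\<close>, the
    \<open>n\<close>-th power consumes \<open>n\<close> and one remains for decay.\<close>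
  define \<beta> where "\<beta> = b / (real n + 1)"
  define c where "c = 1 + a * (real p ^ p / \<beta> ^ p)"
  have \<beta>: "\<beta> > 0" using assms by (simp add: \<beta>_def)
  show thesis
  proof (rule that)
    fix x :: real assume x: "0 \<le> x"
    have "(\<beta> * x) ^ p \<le> real p ^ p * exp (\<beta> * x)"
      using x \<beta> by (intro power_le_exp) simp
    then have "x ^ p \<le> (real p ^ p / \<beta> ^ p) * exp (\<beta> * x)"
      using \<beta> by (simp add: power_mult_distrib field_simps)
    then have "a * x ^ p \<le> a * ((real p ^ p / \<beta> ^ p) * exp (\<beta> * x))"
      using assms(1) by (rule mult_left_mono)
    moreover have "1 \<le> exp (\<beta> * x)" using x \<beta> by simp
    moreover have "c * exp (\<beta> * x) = exp (\<beta> * x) + a * ((real p ^ p / \<beta> ^ p) * exp (\<beta> * x))"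
      by (simp add: c_def algebra_simps)
    ultimately have "1 + a * x ^ p \<le> c * exp (\<beta> * x)"
      by linarith
    then have "(1 + a * x ^ p) ^ n \<le> (c * exp (\<beta> * x)) ^ n"
      using x assms(1) by (intro power_mono) auto
    also have "\<dots> = c ^ n * exp (real n * (\<beta> * x))"
      by (simp add: power_mult_distrib exp_of_nat_mult)
    finally have "(1 + a * x ^ p) ^ n * exp (- (b * x)) \<le> c ^ n * exp (real n * (\<beta> * x)) * exp (- (b * x))"
      by (rule mult_right_mono) simp
    also have "\<dots> = c ^ n * exp (- (\<beta> * x))"
    proof -
      have "b = (real n + 1) * \<beta>" by (simp add: \<beta>_def)
      then have "real n * (\<beta> * x) + - (b * x) = - (\<beta> * x)" by (simp add: algebra_simps)
      then show ?thesis by (simp add: mult.assoc exp_add[symmetric])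
    qed
    also have "\<dots> \<le> c ^ n * 1"
      using x \<beta> assms(1) by (intro mult_left_mono) (auto simp: c_def)
    finally show "(1 + a * x ^ p) ^ n * exp (- (b * x)) \<le> c ^ n" by simp
  qed
qed

text \<open>The reciprocal root of \<open>det \<Sigma>\<close> is the root of
  \<open>det (matrix_inv \<Sigma>)\<close>, hence at most one plus this determinant, which the trace
  bounds; the powers of \<open>2 * pi\<close> are at least 1 and are dropped.\<close>

lemma joint_density_le:
  fixes x :: "real^'p^'n"
  assumes \<Sigma>: "\<Sigma> \<in> spd_matrices"
    and le: "\<beta> * trace (matrix_inv \<Sigma>) \<le> (\<Sum>i\<in>UNIV. (x $ i - \<theta>) \<bullet> (matrix_inv \<Sigma> *v (x $ i - \<theta>)))"
  shows "joint_density x \<theta> \<Sigma> \<le>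
    (1 + fact CARD('p) * trace (matrix_inv \<Sigma>) ^ CARD('p)) ^ CARD('n) * exp (- (\<beta> / 2 * trace (matrix_inv \<Sigma>)))"
proof -
  define \<tau> where "\<tau> = trace (matrix_inv \<Sigma>)"
  define D where "D = (2 * pi) ^ CARD('p) * det \<Sigma>"
  have det: "det \<Sigma> > 0" by (rule spd_det_pos[OF \<Sigma>])
  have "1 \<le> (2 * pi) ^ CARD('p)" using pi_gt3 by (intro one_le_power) simp
  then have D: "D \<ge> det \<Sigma>" using det by (simp add: D_def)
  have "1 / sqrt D \<le> 1 / sqrt (det \<Sigma>)"
    using D det by (intro divide_left_mono) auto
  also have "\<dots> = sqrt (det (matrix_inv \<Sigma>))"
    by (simp add: det_matrix_inv spd_invertible \<Sigma> real_sqrt_divide)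
  also have "\<dots> \<le> 1 + det (matrix_inv \<Sigma>)"
  proof (rule real_le_lsqrt)
    have "det (matrix_inv \<Sigma>) > 0" by (intro spd_det_pos spd_matrix_inv \<Sigma>)
    then show "det (matrix_inv \<Sigma>) \<le> (1 + det (matrix_inv \<Sigma>))\<^sup>2" "0 \<le> 1 + det (matrix_inv \<Sigma>)"
      by (auto simp: power2_eq_square algebra_simps)
  qed
  also have "\<dots> \<le> 1 + fact CARD('p) * \<tau> ^ CARD('p)"
    unfolding \<tau>_def by (intro add_left_mono spd_det_le spd_matrix_inv \<Sigma>)
  finally have "(1 / sqrt D) ^ CARD('n) \<le> (1 + fact CARD('p) * \<tau> ^ CARD('p)) ^ CARD('n)"
    using D det by (intro power_mono) auto
  moreover have "exp (- (\<Sum>i\<in>UNIV. (x $ i - \<theta>) \<bullet> (matrix_inv \<Sigma> *v (x $ i - \<theta>))) / 2) \<le> exp (- (\<beta> / 2 * \<tau>))"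
    using le by (simp add: \<tau>_def)
  ultimately have "(1 / sqrt D) ^ CARD('n) * exp (- (\<Sum>i\<in>UNIV. (x $ i - \<theta>) \<bullet> (matrix_inv \<Sigma> *v (x $ i - \<theta>))) / 2)
      \<le> (1 + fact CARD('p) * \<tau> ^ CARD('p)) ^ CARD('n) * exp (- (\<beta> / 2 * \<tau>))"
    using spd_trace_nonneg[OF spd_matrix_inv[OF \<Sigma>]]
    by (intro mult_mono) (auto simp: \<tau>_def)
  then show ?thesis
    unfolding joint_density_eq D_def \<tau>_def by (simp add: power_one_over)
qed

text \<open>By bounded convergence this makes the marginal densities finite and continuous, without
  any assumption on the priors.\<close>
lemma joint_density_locally_bounded:
  fixes x0 :: "real^'p^'n"
  assumes x0: "x0 \<in> regular_samples" and n: "CARD('n) > 1"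
  obtains U K where "open U" "x0 \<in> U"
    "\<And>x \<theta> \<Sigma>. x \<in> U \<Longrightarrow> \<Sigma> \<in> spd_matrices \<Longrightarrow> joint_density x \<theta> \<Sigma> \<le> K"
proof -
  define s where "s P x = (\<Sum>a\<in>UNIV. \<Sum>b\<in>UNIV. P $ a $ b * sample_cov x $ a $ b)" for P :: "real^'p^'p" and x :: "real^'p^'n"
  obtain \<beta> where \<beta>: "\<beta> > 0" "\<And>P. P \<in> spd_matrices \<Longrightarrow> \<beta> * trace P \<le> s P x0"
    using trace_le_sum_form_deviation[OF x0 n] unfolding s_def by blast
  \<comment> \<open>Half of \<open>\<beta>\<close> is given up so that the trace bound at
    \<open>x0\<close> survives on a neighbourhood.\<close>
  obtain U where U: "open U" "x0 \<in> U"
    "\<And>x. x \<in> U \<Longrightarrow> (\<Sum>a\<in>UNIV. \<Sum>b\<in>UNIV. \<bar>sample_cov x $ a $ b - sample_cov x0 $ a $ b\<bar>) < \<beta> / 2"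
    using eventually_sample_cov_close[of "\<beta> / 2" x0] \<beta>(1) unfolding eventually_nhds by auto
  have low: "\<beta> / 2 * trace P \<le> s P x" if x: "x \<in> U" and P: "P \<in> spd_matrices" for x P
  proof -
    have "s P x0 - s P x = (\<Sum>a\<in>UNIV. \<Sum>b\<in>UNIV. P $ a $ b * (sample_cov x0 $ a $ b - sample_cov x $ a $ b))"
      by (simp add: s_def sum_subtractf[symmetric] right_diff_distrib)
    also have "\<dots> \<le> (\<Sum>a\<in>UNIV. \<Sum>b\<in>UNIV. trace P * \<bar>sample_cov x $ a $ b - sample_cov x0 $ a $ b\<bar>)"
    proof (intro sum_mono)
      fix a b
      have "P $ a $ b * (sample_cov x0 $ a $ b - sample_cov x $ a $ b)
          \<le> \<bar>P $ a $ b\<bar> * \<bar>sample_cov x0 $ a $ b - sample_cov x $ a $ b\<bar>"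
        by (metis abs_ge_self abs_mult)
      also have "\<dots> \<le> trace P * \<bar>sample_cov x0 $ a $ b - sample_cov x $ a $ b\<bar>"
        by (intro mult_right_mono spd_component_le_trace P) simp
      finally show "P $ a $ b * (sample_cov x0 $ a $ b - sample_cov x $ a $ b)
          \<le> trace P * \<bar>sample_cov x $ a $ b - sample_cov x0 $ a $ b\<bar>"
        by (simp add: abs_minus_commute)
    qed
    also have "\<dots> = trace P * (\<Sum>a\<in>UNIV. \<Sum>b\<in>UNIV. \<bar>sample_cov x $ a $ b - sample_cov x0 $ a $ b\<bar>)"
      by (simp add: sum_distrib_left)
    also have "\<dots> \<le> trace P * (\<beta> / 2)"
      using U(3)[OF x] spd_trace_nonneg[OF P] by (intro mult_left_mono) auto
    finally show ?thesis using \<beta>(2)[OF P] by (simp add: algebra_simps)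
  qed
  define \<gamma> where "\<gamma> = (real CARD('n) - 1) * (\<beta> / 2)"
  have "\<gamma> / 2 > 0" using \<beta>(1) n by (simp add: \<gamma>_def)
  then obtain K where K: "\<And>t. 0 \<le> t \<Longrightarrow> (1 + fact CARD('p) * t ^ CARD('p)) ^ CARD('n) * exp (- (\<gamma> / 2 * t)) \<le> K"
    using poly_exp_bounded[of "fact CARD('p)" "\<gamma> / 2"] by (metis fact_ge_zero)
  show thesis
  proof (rule that[OF U(1,2)])
    fix x \<theta> and \<Sigma> :: "real^'p^'p" assume x: "x \<in> U" and \<Sigma>: "\<Sigma> \<in> spd_matrices"
    note P = spd_matrix_inv[OF \<Sigma>]
    have "\<gamma> * trace (matrix_inv \<Sigma>) \<le> (real CARD('n) - 1) * s (matrix_inv \<Sigma>) x"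
      unfolding \<gamma>_def mult.assoc using n by (intro mult_left_mono low x P) auto
    also have "\<dots> = (\<Sum>i\<in>UNIV. (x $ i - sample_mean x) \<bullet> (matrix_inv \<Sigma> *v (x $ i - sample_mean x)))"
      unfolding s_def by (rule sum_form_deviation[OF n, symmetric])
    also have "\<dots> \<le> (\<Sum>i\<in>UNIV. (x $ i - \<theta>) \<bullet> (matrix_inv \<Sigma> *v (x $ i - \<theta>)))"
      by (rule sum_form_deviation_le[OF P])
    finally have "joint_density x \<theta> \<Sigma> \<le> (1 + fact CARD('p) * trace (matrix_inv \<Sigma>) ^ CARD('p)) ^ CARD('n) * exp (- (\<gamma> / 2 * trace (matrix_inv \<Sigma>)))"
      by (rule joint_density_le[OF \<Sigma>])
    also have "\<dots> \<le> K" by (intro K spd_trace_nonneg P)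
    finally show "joint_density x \<theta> \<Sigma> \<le> K" .
  qed
qed

lemma continuous_on_joint_density_param:
  "continuous_on (T \<times> spd_matrices) (\<lambda>z. joint_density x (fst z) (snd z))"
proof -
  have "continuous_on (T \<times> spd_matrices) (\<lambda>z. matrix_inv (snd z))"
    by (rule continuous_on_matrix_inv) (auto intro!: continuous_intros spd_invertible)
  moreover have "continuous_on (T \<times> spd_matrices) (\<lambda>z. det (snd z))"
    by (intro continuous_on_det continuous_intros)
  ultimately show ?thesis
    unfolding joint_density_eq
    by (intro continuous_intros) (auto dest: spd_det_pos)
qed

lemma continuous_on_joint_density_sample:
  "continuous_on S (\<lambda>x :: real^'p^'n. joint_density x \<theta> \<Sigma>)"
proof -
  have "continuous_on S (\<lambda>x :: real^'p^'n. inverse (sqrt ((2 * pi) ^ CARD('p) * det \<Sigma>) ^ CARD('n)) *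
    exp (- (\<Sum>i\<in>UNIV. (x $ i - \<theta>) \<bullet> (matrix_inv \<Sigma> *v (x $ i - \<theta>))) / 2))"
    by (intro continuous_intros) auto
  then show ?thesis unfolding joint_density_eq by (simp add: field_simps)
qed

section \<open>Priors and the continuity of their marginals\<close>

definition marginal :: "((real ^ 'p) \<times> (real ^ 'p ^ 'p)) measure \<Rightarrow> real^'p^'n \<Rightarrow> real" where
  "marginal G x = (\<integral>z. joint_density x (fst z) (snd z) \<partial>G)"

text \<open>\<open>T\<close> is the parameter set of the mean: \<open>{0}\<close> for the null
  prior, \<open>C - {0}\<close> for the alternative. Both priors share the facts below.\<close>

locale prior = prob_space G for G :: "((real ^ 'p) \<times> (real ^ 'p ^ 'p)) measure" +
  fixes T :: "(real^'p) set"
  assumes sets_G: "sets G = sets (restrict_space borel (T \<times> spd_matrices))"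
begin

lemma space_G: "space G = T \<times> spd_matrices"
  using sets_eq_imp_space_eq[OF sets_G] by (simp add: space_restrict_space)

lemma measurable_continuous_on:
  fixes f :: "_ \<Rightarrow> real"
  assumes "continuous_on (T \<times> spd_matrices) f" shows "f \<in> borel_measurable G"
  using borel_measurable_continuous_on_restrict[OF assms] measurable_cong_sets[OF sets_G refl] by blast

lemma measurable_joint_density: "(\<lambda>z. joint_density x (fst z) (snd z)) \<in> borel_measurable G"
  by (intro measurable_continuous_on continuous_on_joint_density_param)

lemma integrable_joint_density:
  fixes x :: "real^'p^'n"
  assumes "x \<in> regular_samples" "CARD('n) > 1"
  shows "integrable G (\<lambda>z. joint_density x (fst z) (snd z))"
proof -
  obtain U K where U: "open U" "x \<in> U"
    "\<And>x \<theta> \<Sigma>. x \<in> U \<Longrightarrow> \<Sigma> \<in> spd_matrices \<Longrightarrow> joint_density x \<theta> \<Sigma> \<le> K"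
    using joint_density_locally_bounded[OF assms] by blast
  show ?thesis
    by (rule integrable_const_bound[of _ K])
      (use U space_G in \<open>auto intro!: AE_I2 measurable_joint_density simp: less_imp_le[OF joint_density_pos]\<close>)
qed

text \<open>Passes from the extended marginals of \<open>proper_Bayes_test\<close> to real ones,
  which the local bound makes legitimate on regular samples.\<close>

lemma nn_integral_joint_density:
  fixes x :: "real^'p^'n"
  assumes "x \<in> regular_samples" "CARD('n) > 1"
  shows "(\<integral>\<^sup>+ (\<theta>, \<Sigma>). ennreal (joint_density x \<theta> \<Sigma>) \<partial>G) = ennreal (marginal G x)"
  unfolding marginal_def case_prod_beta
  by (rule nn_integral_eq_integral[OF integrable_joint_density[OF assms]])
    (use space_G in \<open>auto intro!: AE_I2 simp: less_imp_le[OF joint_density_pos]\<close>)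

lemma marginal_nonneg: "0 \<le> marginal G x"
  unfolding marginal_def
  by (intro integral_nonneg_AE AE_I2) (use space_G in \<open>auto simp: less_imp_le[OF joint_density_pos]\<close>)

lemma continuous_on_marginal:
  assumes n: "CARD('n) > 1"
  shows "continuous_on regular_samples (marginal G :: real^'p^'n \<Rightarrow> real)"
proof -
  have "\<exists>U. open U \<and> x0 \<in> U \<and> continuous_on U (marginal G)" if x0: "x0 \<in> regular_samples" for x0 :: "real^'p^'n"
  proof -
    obtain U K where U: "open U" "x0 \<in> U"
      "\<And>x \<theta> \<Sigma>. x \<in> U \<Longrightarrow> \<Sigma> \<in> spd_matrices \<Longrightarrow> joint_density x \<theta> \<Sigma> \<le> K"
      using joint_density_locally_bounded[OF x0 n] by blast
    have "continuous_on U (marginal G)"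
      unfolding continuous_on_sequentially comp_def marginal_def
    proof (intro allI ballI impI, elim conjE)
      fix u a assume a: "a \<in> U" and u: "\<forall>k. u k \<in> U" "u \<longlonglongrightarrow> a"
      show "(\<lambda>k. \<integral>z. joint_density (u k) (fst z) (snd z) \<partial>G) \<longlonglongrightarrow> (\<integral>z. joint_density a (fst z) (snd z) \<partial>G)"
      proof (rule integral_dominated_convergence[where w = "\<lambda>_. K"])
        show "AE z in G. (\<lambda>k. joint_density (u k) (fst z) (snd z)) \<longlonglongrightarrow> joint_density a (fst z) (snd z)"
          using continuous_on_joint_density_sample[of UNIV, unfolded continuous_on_sequentially comp_def] u(2)
          by (intro AE_I2) blast
        show "AE z in G. norm (joint_density (u k) (fst z) (snd z)) \<le> K" for k
          using u(1) U(3) by (intro AE_I2) (auto simp: space_G less_imp_le[OF joint_density_pos])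
      qed (auto intro: measurable_joint_density)
    qed
    with U(1,2) show ?thesis by blast
  qed
  then show ?thesis
    by (meson continuous_at_imp_continuous_on continuous_on_eq_continuous_at)
qed

end

section \<open>From almost everywhere to everywhere\<close>

lemma open_AE_lborel_empty:
  fixes W :: "'a::euclidean_space set"
  assumes "open W" "AE x in lborel. x \<notin> W" shows "W = {}"
proof (rule ccontr)
  assume "W \<noteq> {}"
  then have "\<not> negligible W" using assms(1) by (intro open_not_negligible)
  moreover have "W \<in> null_sets lborel"
    using assms by (subst AE_iff_null_sets) auto
  then have "negligible W"
    by (simp add: negligible_iff_null_sets null_sets_completionI)
  ultimately show False by simp
qed

text \<open>A strict inequality of the wrong sign would persist on a nonempty open subset of
  \<open>W\<close> by continuity. Such a set has positive measure, and the Bayes rule there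
  contradicts the actual decision.\<close>

lemma marginal_sign:
  fixes R :: "(real^'p^'n) set"
  assumes n: "CARD('n) > 1" and G0: "prior G0 T0" and G1: "prior G1 T1" and c: "c > 0"
    and bayes: "AE x in lborel.
           let m0 = (\<integral>\<^sup>+ (\<theta>, \<Sigma>). ennreal (joint_density x \<theta> \<Sigma>) \<partial>G0);
               m1 = (\<integral>\<^sup>+ (\<theta>, \<Sigma>). ennreal (joint_density x \<theta> \<Sigma>) \<partial>G1)
           in (m1 > ennreal c * m0 \<longrightarrow> x \<notin> R) \<and> (m1 < ennreal c * m0 \<longrightarrow> x \<in> R)"
    and W: "open W" "W \<subseteq> regular_samples" "x \<in> W"
  shows "W \<subseteq> R \<Longrightarrow> marginal G1 x \<le> c * marginal G0 x"
    and "W \<inter> R = {} \<Longrightarrow> c * marginal G0 x \<le> marginal G1 x"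
proof -
  have ae: "AE x in lborel. x \<in> W \<longrightarrow> (marginal G1 x > c * marginal G0 x \<longrightarrow> x \<notin> R) \<and> (marginal G1 x < c * marginal G0 x \<longrightarrow> x \<in> R)"
    using bayes
  proof eventually_elim
    case (elim x)
    show ?case
    proof
      assume "x \<in> W"
      then have x: "x \<in> regular_samples" using W by auto
      show "(marginal G1 x > c * marginal G0 x \<longrightarrow> x \<notin> R) \<and> (marginal G1 x < c * marginal G0 x \<longrightarrow> x \<in> R)"
        using elim c unfolding Let_def prior.nn_integral_joint_density[OF G0 x n] prior.nn_integral_joint_density[OF G1 x n]
        by (simp add: ennreal_mult[symmetric] prior.marginal_nonneg[OF G0] prior.marginal_nonneg[OF G1] ennreal_less_iff)
    qed
  qed
  have cont: "continuous_on W (marginal G1)" "continuous_on W (\<lambda>x. c * marginal G0 x)"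
    by (intro continuous_intros continuous_on_subset[OF prior.continuous_on_marginal[OF G1 n] W(2)]
        continuous_on_subset[OF prior.continuous_on_marginal[OF G0 n] W(2)])+
  have op: "open {x \<in> W. f x < g x}" if "continuous_on W f" "continuous_on W g" for f g :: "_ \<Rightarrow> real"
  proof -
    have "open ((\<lambda>x. g x - f x) -` {0<..} \<inter> W)"
      using that W(1) by (intro continuous_on_open_vimage[THEN iffD1, rule_format] continuous_intros) auto
    moreover have "(\<lambda>x. g x - f x) -` {0<..} \<inter> W = {x \<in> W. f x < g x}" by auto
    ultimately show ?thesis by simp
  qed
  show "marginal G1 x \<le> c * marginal G0 x" if "W \<subseteq> R"
  proof -
    have "{x \<in> W. c * marginal G0 x < marginal G1 x} = {}"
      by (rule open_AE_lborel_empty[OF op[OF cont(2,1)]]) (use ae that in \<open>auto elim!: eventually_mono\<close>)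
    with W(3) show ?thesis by auto
  qed
  show "c * marginal G0 x \<le> marginal G1 x" if "W \<inter> R = {}"
  proof -
    have "{x \<in> W. marginal G1 x < c * marginal G0 x} = {}"
      by (rule open_AE_lborel_empty[OF op[OF cont]]) (use ae that in \<open>auto elim!: eventually_mono\<close>)
    with W(3) show ?thesis by auto
  qed
qed

section \<open>A two-parameter family of samples\<close>

text \<open>The vectors with coordinate sum zero form a hyperplane of dimension
  \<open>CARD('n) - 1\<close>, large enough for \<open>CARD('p)\<close> orthonormal ones. They serve
  to build samples with prescribed mean and covariance.\<close>

lemma orthonormal_centered_vectors:
  assumes "CARD('n) > CARD('p)"
  obtains g :: "'p::finite \<Rightarrow> real^'n"
  where "\<And>k k'. (\<Sum>i\<in>UNIV. g k $ i * g k' $ i) = (if k = k' then 1 else 0)" "\<And>k. (\<Sum>i\<in>UNIV. g k $ i) = 0"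
proof -
  define S where "S = {v :: real^'n. 1 \<bullet> v = 0}"
  have "subspace S" unfolding S_def by (rule subspace_hyperplane)
  then obtain B where B: "B \<subseteq> S" "pairwise orthogonal B" "\<And>v. v \<in> B \<Longrightarrow> norm v = 1"
    "independent B" "card B = dim S"
    using orthonormal_basis_subspace by metis
  have "(1 :: real^'n) \<noteq> 0" by simp
  then have "dim S = CARD('n) - 1" unfolding S_def by (simp add: dim_hyperplane)
  with B(5) assms have "card (UNIV :: 'p set) \<le> card B" by simp
  moreover have "finite B" using B(4) by (rule independent_imp_finite)
  ultimately obtain g :: "'p \<Rightarrow> real^'n" where g: "range g \<subseteq> B" "inj g"
    using card_le_inj[of "UNIV :: 'p set" B] by auto
  show thesis
  proof (rule that)
    fix k k'
    have "g k \<bullet> g k' = (if k = k' then 1 else 0)"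
    proof (cases "k = k'")
      case True
      then show ?thesis using B(3)[of "g k"] g(1) by (auto simp: norm_eq_1)
    next
      case False
      then have "g k \<noteq> g k'" using g(2) by (auto dest: injD)
      moreover have "g k \<in> B" "g k' \<in> B" using g(1) by auto
      ultimately show ?thesis using B(2) False by (auto simp: pairwise_def orthogonal_def)
    qed
    then show "(\<Sum>i\<in>UNIV. g k $ i * g k' $ i) = (if k = k' then 1 else 0)" by (simp add: inner_vec_def)
    have "g k \<in> S" using g(1) B(1) by auto
    then show "(\<Sum>i\<in>UNIV. g k $ i) = 0" by (simp add: S_def inner_vec_def)
  qed
qed

text \<open>The matrix \<open>\<Sum>\<^sub>i X\<^sub>i X\<^sub>i'\<close> is affine in \<open>s\<close> and free of \<open>\<rho>\<close>, the vector \<open>\<Sum>\<^sub>i X\<^sub>i\<close> is \<open>\<rho>\<close> times an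
  affine function of \<open>s\<close>, and Hotelling's statistic depends on \<open>\<rho>\<close> only. The sample mean leaves the
  cone as \<open>s\<close> becomes negative.\<close>
locale sample_family =
  fixes g :: "'p::finite \<Rightarrow> real^'n" and j l :: 'p and w0 :: "'p \<Rightarrow> real"
  assumes jl: "j \<noteq> l"
    and n: "CARD('n) > 1"
    and g_orth: "\<And>k k'. (\<Sum>i\<in>UNIV. g k $ i * g k' $ i) = (if k = k' then 1 else 0)"
    and g_sum: "\<And>k. (\<Sum>i\<in>UNIV. g k $ i) = 0"
    and w0_j: "w0 j = 1" and w0_pos: "\<And>k. 0 < w0 k"
begin

definition wt :: "real \<Rightarrow> real^'p" where
  "wt s = (\<chi> k. if k = l then s else w0 k)"

text \<open>In the matrix of second moments, the value 0 at \<open>j\<close> makes column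
  \<open>j\<close> equal to \<open>wt s\<close>, and the root at \<open>l\<close> makes the diagonal
  entry there constantly 1, which keeps the matrix affine in \<open>s\<close>.\<close>

definition res :: "real \<Rightarrow> 'p \<Rightarrow> real" where
  "res s k = (if k = j then 0 else if k = l then sqrt (1 - s\<^sup>2) else 1)"

text \<open>The factor \<open>sqrt (1 - \<rho>\<^sup>2)\<close> offsets the contribution of the mean
  to the second moments, so that \<open>\<rho>\<close> cancels from them.\<close>

definition dev :: "real \<Rightarrow> real \<Rightarrow> 'n \<Rightarrow> 'p \<Rightarrow> real" where
  "dev \<rho> s i k = sqrt (1 - \<rho>\<^sup>2) * wt s $ k * g j $ i + res s k * g k $ i"

definition smp :: "real \<Rightarrow> real \<Rightarrow> real^'p^'n" where
  "smp \<rho> s = (\<chi> i k. \<rho> / sqrt (real CARD('n)) * wt s $ k + dev \<rho> s i k)"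

lemma sum_dev: "(\<Sum>i\<in>UNIV. dev \<rho> s i k) = 0"
  by (simp add: dev_def sum.distrib sum_distrib_left[symmetric] g_sum)

lemma sum_dev_dev:
  assumes "\<bar>\<rho>\<bar> < 1"
  shows "(\<Sum>i\<in>UNIV. dev \<rho> s i a * dev \<rho> s i b)
    = (1 - \<rho>\<^sup>2) * (wt s $ a * wt s $ b) + (if a = b then (res s a)\<^sup>2 else 0)"
proof -
  define \<sigma> where "\<sigma> = sqrt (1 - \<rho>\<^sup>2)"
  have \<sigma>: "\<sigma> * \<sigma> = 1 - \<rho>\<^sup>2" using assms by (simp add: \<sigma>_def abs_square_le_1 less_imp_le)
  have "(\<Sum>i\<in>UNIV. dev \<rho> s i a * dev \<rho> s i b)
    = \<sigma> * \<sigma> * wt s $ a * wt s $ b * (\<Sum>i\<in>UNIV. g j $ i * g j $ i)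
      + \<sigma> * wt s $ a * res s b * (\<Sum>i\<in>UNIV. g j $ i * g b $ i)
      + \<sigma> * wt s $ b * res s a * (\<Sum>i\<in>UNIV. g a $ i * g j $ i)
      + res s a * res s b * (\<Sum>i\<in>UNIV. g a $ i * g b $ i)"
    unfolding sum_distrib_left sum.distrib[symmetric]
    by (rule sum.cong) (auto simp: dev_def \<sigma>_def algebra_simps)
  then show ?thesis
    by (simp add: g_orth \<sigma> res_def power2_eq_square)
qed

lemma sum_smp: "(\<Sum>i\<in>UNIV. smp \<rho> s $ i) = (sqrt (real CARD('n)) * \<rho>) *\<^sub>R wt s"
proof -
  define N where "N = sqrt (real CARD('n))"
  have N: "N > 0" "real CARD('n) = N * N" by (simp_all add: N_def)
  show ?thesis
    unfolding N_def[symmetric] using N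
    by (simp add: vec_eq_iff smp_def N_def[symmetric] sum.distrib sum_dev)
qed

lemma sum_smp_smp:
  assumes "\<bar>\<rho>\<bar> < 1"
  shows "(\<Sum>i\<in>UNIV. smp \<rho> s $ i $ a * smp \<rho> s $ i $ b) = wt s $ a * wt s $ b + (if a = b then (res s a)\<^sup>2 else 0)"
proof -
  define r where "r = \<rho> / sqrt (real CARD('n))"
  have r: "real CARD('n) * (r * r) = \<rho>\<^sup>2"
    by (simp add: r_def power2_eq_square)
  have "(\<Sum>i\<in>UNIV. smp \<rho> s $ i $ a * smp \<rho> s $ i $ b)
    = (\<Sum>i\<in>(UNIV::'n set). r * r * (wt s $ a * wt s $ b)) + r * wt s $ a * (\<Sum>i\<in>UNIV. dev \<rho> s i b)
      + r * wt s $ b * (\<Sum>i\<in>UNIV. dev \<rho> s i a) + (\<Sum>i\<in>UNIV. dev \<rho> s i a * dev \<rho> s i b)"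
    unfolding sum_distrib_left sum.distrib[symmetric]
    by (rule sum.cong) (auto simp: smp_def r_def[symmetric] algebra_simps)
  also have "\<dots> = (real CARD('n) * (r * r)) * (wt s $ a * wt s $ b) + (1 - \<rho>\<^sup>2) * (wt s $ a * wt s $ b)
     + (if a = b then (res s a)\<^sup>2 else 0)"
    by (simp add: sum_dev sum_dev_dev[OF assms])
  finally show ?thesis unfolding r by (simp add: algebra_simps)
qed

lemma sample_mean_smp: "sample_mean (smp \<rho> s) = (\<rho> / sqrt (real CARD('n))) *\<^sub>R wt s"
  unfolding sample_mean_def sum_smp by (simp add: field_simps)

lemma sample_cov_smp:
  assumes "\<bar>\<rho>\<bar> < 1"
  shows "sample_cov (smp \<rho> s) $ a $ b = ((1 - \<rho>\<^sup>2) * (wt s $ a * wt s $ b) + (if a = b then (res s a)\<^sup>2 else 0)) / (real CARD('n) - 1)"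
proof -
  have "(smp \<rho> s $ i - sample_mean (smp \<rho> s)) $ k = dev \<rho> s i k" for i k
    by (simp add: sample_mean_smp) (simp add: smp_def)
  then show ?thesis
    unfolding sample_cov_component by (simp only: sum_dev_dev[OF assms])
qed

lemma wt_j: "wt s $ j = 1" and wt_l: "wt s $ l = s"
  using jl w0_j by (auto simp: wt_def)

text \<open>The form is a sum of two nonnegative parts. The residual part detects every coordinate
  except \<open>j\<close>; a vector supported at \<open>j\<close> is detected by
  \<open>v \<bullet> wt s\<close>, because \<open>wt s $ j = 1\<close>.\<close>

lemma smp_regular:
  assumes \<rho>: "\<bar>\<rho>\<bar> < 1" and s: "\<bar>s\<bar> < 1"
  shows "smp \<rho> s \<in> regular_samples"
proof -
  have \<rho>2: "0 < 1 - \<rho>\<^sup>2" using \<rho> by (simp add: abs_square_less_1)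
  have "v \<bullet> (sample_cov (smp \<rho> s) *v v) > 0" if v: "v \<noteq> 0" for v
  proof -
    have "v \<bullet> (sample_cov (smp \<rho> s) *v v)
      = (\<Sum>a\<in>UNIV. \<Sum>b\<in>UNIV. ((1 - \<rho>\<^sup>2) * ((v $ a * wt s $ a) * (v $ b * wt s $ b)) + (if a = b then (res s a * v $ a)\<^sup>2 else 0)) / (real CARD('n) - 1))"
      unfolding form_eq_sum sample_cov_smp[OF \<rho>]
      by (intro sum.cong refl) (auto simp: power2_eq_square field_simps)
    also have "\<dots> = ((1 - \<rho>\<^sup>2) * (v \<bullet> wt s)\<^sup>2 + (\<Sum>a\<in>UNIV. (res s a * v $ a)\<^sup>2)) / (real CARD('n) - 1)"
      by (simp add: sum_divide_distrib[symmetric] sum.distrib inner_vec_def power2_eq_square sum_product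
          sum_distrib_left[symmetric])
    finally have eq: "v \<bullet> (sample_cov (smp \<rho> s) *v v)
      = ((1 - \<rho>\<^sup>2) * (v \<bullet> wt s)\<^sup>2 + (\<Sum>a\<in>UNIV. (res s a * v $ a)\<^sup>2)) / (real CARD('n) - 1)" .
    have "0 < (1 - \<rho>\<^sup>2) * (v \<bullet> wt s)\<^sup>2 + (\<Sum>a\<in>UNIV. (res s a * v $ a)\<^sup>2)"
    proof (cases "\<exists>a. a \<noteq> j \<and> v $ a \<noteq> 0")
      case True
      then obtain a where a: "a \<noteq> j" "v $ a \<noteq> 0" by blast
      have "res s a \<noteq> 0" using a(1) s abs_square_less_1[of s] by (auto simp: res_def)
      then have "0 < (\<Sum>a\<in>UNIV. (res s a * v $ a)\<^sup>2)"
        using a(2) by (intro sum_pos2[of _ a]) auto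
      with \<rho>2 show ?thesis by (intro add_nonneg_pos) auto
    next
      case False
      then have v_eq: "v = v $ j *\<^sub>R axis j 1" by (auto simp: vec_eq_iff axis_def)
      with v have "v $ j \<noteq> 0" by auto
      moreover have "v \<bullet> wt s = v $ j"
        by (subst v_eq) (simp add: inner_axis' wt_j)
      ultimately show ?thesis using \<rho>2 by (intro add_pos_nonneg sum_nonneg) auto
    qed
    then show ?thesis unfolding eq using n by simp
  qed
  then show ?thesis by (simp add: regular_samples_def spd_matrices_def transpose_sample_cov)
qed

text \<open>Column \<open>j\<close> of the covariance is a multiple of \<open>wt s\<close>, so the
  inverse sends \<open>wt s\<close> to a multiple of \<open>axis j 1\<close> and need not be
  computed.\<close>

lemma hotelling_smp:
  assumes \<rho>: "\<bar>\<rho>\<bar> < 1" and s: "\<bar>s\<bar> < 1"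
  shows "hotelling (smp \<rho> s) = (real CARD('n) - 1) * \<rho>\<^sup>2 / (1 - \<rho>\<^sup>2)"
proof -
  define S where "S = sample_cov (smp \<rho> s)"
  define N where "N = real CARD('n)"
  have N: "N > 1" using n by (simp add: N_def)
  have \<rho>2: "0 < 1 - \<rho>\<^sup>2" using \<rho> by (simp add: abs_square_less_1)
  have S: "S \<in> spd_matrices" using smp_regular[OF assms] by (simp add: S_def regular_samples_def)
  have "S *v axis j 1 = ((1 - \<rho>\<^sup>2) / (N - 1)) *\<^sub>R wt s"
    by (simp add: matrix_vector_mult_basis column_def vec_eq_iff S_def sample_cov_smp[OF \<rho>] wt_j res_def N_def)
  then have "wt s = ((N - 1) / (1 - \<rho>\<^sup>2)) *\<^sub>R (S *v axis j 1)"
    using \<rho>2 N by simp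
  then have "matrix_inv S *v wt s = ((N - 1) / (1 - \<rho>\<^sup>2)) *\<^sub>R axis j 1"
    by (metis matrix_inv_cancel(2)[OF spd_invertible[OF S]] matrix_vector_mult_scaleR)
  then have "inner_wrt S (wt s) (wt s) = (N - 1) / (1 - \<rho>\<^sup>2)"
    by (simp add: inner_wrt_def inner_axis wt_j)
  then show ?thesis
    using N by (simp add: hotelling_def sample_mean_smp inner_wrt_scale S_def[symmetric] N_def[symmetric] power_divide)
qed

lemma sample_cov_smp_l:
  assumes \<rho>: "\<bar>\<rho>\<bar> < 1" and s: "\<bar>s\<bar> < 1"
  shows "0 < sample_cov (smp \<rho> s) $ l $ l" "sample_cov (smp \<rho> s) $ l $ l \<le> 1 / (real CARD('n) - 1)"
proof -
  have "sample_cov (smp \<rho> s) \<in> spd_matrices" using smp_regular[OF assms] by (simp add: regular_samples_def)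
  from spd_pos[OF this, of "axis l 1"] show "0 < sample_cov (smp \<rho> s) $ l $ l" by (simp add: form_axis)
  have "(res s l)\<^sup>2 = 1 - s\<^sup>2" using jl s by (simp add: res_def abs_square_le_1 less_imp_le)
  then have "sample_cov (smp \<rho> s) $ l $ l = (1 - \<rho>\<^sup>2 * s\<^sup>2) / (real CARD('n) - 1)"
    by (simp add: sample_cov_smp[OF \<rho>] wt_l power2_eq_square algebra_simps)
  also have "\<dots> \<le> 1 / (real CARD('n) - 1)"
    using n by (intro divide_right_mono) auto
  finally show "sample_cov (smp \<rho> s) $ l $ l \<le> 1 / (real CARD('n) - 1)" .
qed

section \<open>Exponential tilting in the parameters of the family\<close>

definition gram0 :: "'p \<Rightarrow> 'p \<Rightarrow> real" where
  "gram0 a b = wt 0 $ a * wt 0 $ b + (if a = b then (res 0 a)\<^sup>2 else 0)"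

definition gram1 :: "'p \<Rightarrow> 'p \<Rightarrow> real" where
  "gram1 a b = (if a = l then wt 0 $ b else 0) + (if b = l then wt 0 $ a else 0)"

text \<open>A term quadratic in \<open>s\<close> arises only at position \<open>(l, l)\<close>,
  where the contributions \<open>s\<^sup>2\<close> and \<open>1 - s\<^sup>2\<close> add up to
  1.\<close>

lemma gram_affine:
  assumes "\<bar>s\<bar> < 1"
  shows "wt s $ a * wt s $ b + (if a = b then (res s a)\<^sup>2 else 0) = gram0 a b + s * gram1 a b"
proof -
  have "0 \<le> 1 - s\<^sup>2" using assms by (simp add: abs_square_le_1 less_imp_le)
  then show ?thesis
    using jl by (auto simp: gram0_def gram1_def wt_def res_def power2_eq_square)
qed

text \<open>The derivative of the log-density in \<open>s\<close>, itself free of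
  \<open>s\<close>.\<close>

definition slope :: "real \<Rightarrow> (real^'p) \<times> (real^'p^'p) \<Rightarrow> real" where
  "slope \<rho> z = sqrt (real CARD('n)) * \<rho> * (axis l 1 \<bullet> (matrix_inv (snd z) *v fst z))
    - (\<Sum>a\<in>UNIV. \<Sum>b\<in>UNIV. matrix_inv (snd z) $ a $ b * gram1 a b) / 2"

text \<open>The derivative of the log-density in \<open>\<rho>\<close>, itself free of
  \<open>\<rho>\<close>.\<close>

definition tilt :: "real \<Rightarrow> (real^'p) \<times> (real^'p^'p) \<Rightarrow> real" where
  "tilt s z = sqrt (real CARD('n)) * (wt s \<bullet> (matrix_inv (snd z) *v fst z))"

lemma wt_affine: "wt s = wt 0 + s *\<^sub>R axis l 1"
  by (auto simp: wt_def vec_eq_iff axis_def)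

text \<open>This expansion is affine in \<open>s\<close> for fixed \<open>\<rho>\<close> and affine
  in \<open>\<rho>\<close> for fixed \<open>s\<close>; both tilting identities come from it.\<close>

lemma sum_form_smp:
  assumes \<rho>: "\<bar>\<rho>\<bar> < 1" and s: "\<bar>s\<bar> < 1" and P: "P \<in> spd_matrices"
  shows "(\<Sum>i\<in>UNIV. (smp \<rho> s $ i - \<theta>) \<bullet> (P *v (smp \<rho> s $ i - \<theta>)))
    = (\<Sum>a\<in>UNIV. \<Sum>b\<in>UNIV. P $ a $ b * gram0 a b) + s * (\<Sum>a\<in>UNIV. \<Sum>b\<in>UNIV. P $ a $ b * gram1 a b)
      - 2 * (sqrt (real CARD('n)) * \<rho> * (wt s \<bullet> (P *v \<theta>))) + real CARD('n) * (\<theta> \<bullet> (P *v \<theta>))"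
proof -
  let ?x = "smp \<rho> s"
  have "(?x $ i - \<theta>) \<bullet> (P *v (?x $ i - \<theta>)) = ?x $ i \<bullet> (P *v ?x $ i) - 2 * (?x $ i \<bullet> (P *v \<theta>)) + \<theta> \<bullet> (P *v \<theta>)" for i
    using symmetric_form[OF spd_symmetric[OF P], of \<theta> "?x $ i"]
    by (simp add: inner_diff_left inner_diff_right matrix_vector_mult_diff_distrib)
  then have "(\<Sum>i\<in>UNIV. (?x $ i - \<theta>) \<bullet> (P *v (?x $ i - \<theta>)))
    = (\<Sum>i\<in>UNIV. ?x $ i \<bullet> (P *v ?x $ i)) - 2 * ((\<Sum>i\<in>UNIV. ?x $ i) \<bullet> (P *v \<theta>)) + real CARD('n) * (\<theta> \<bullet> (P *v \<theta>))"
    by (simp add: sum.distrib sum_subtractf sum_distrib_left inner_sum_left)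
  also have "(\<Sum>i\<in>UNIV. ?x $ i \<bullet> (P *v ?x $ i)) = (\<Sum>a\<in>UNIV. \<Sum>b\<in>UNIV. P $ a $ b * (\<Sum>i\<in>UNIV. ?x $ i $ a * ?x $ i $ b))"
    unfolding form_eq_sum sum_distrib_left
    by (subst sum.swap, rule sum.cong[OF refl], subst sum.swap) simp
  also have "\<dots> = (\<Sum>a\<in>UNIV. \<Sum>b\<in>UNIV. P $ a $ b * gram0 a b) + s * (\<Sum>a\<in>UNIV. \<Sum>b\<in>UNIV. P $ a $ b * gram1 a b)"
    unfolding sum_smp_smp[OF \<rho>] gram_affine[OF s]
    by (simp add: distrib_left sum.distrib sum_distrib_left mult_ac)
  finally show ?thesis by (simp add: sum_smp)
qed

lemma joint_density_smp_s:
  assumes "\<bar>\<rho>\<bar> < 1" "\<bar>s\<bar> < 1" "\<bar>s'\<bar> < 1" "snd z \<in> spd_matrices"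
  shows "joint_density (smp \<rho> s') (fst z) (snd z)
    = joint_density (smp \<rho> s) (fst z) (snd z) * exp ((s' - s) * slope \<rho> z)"
  using wt_affine[of s] wt_affine[of s']
  unfolding joint_density_eq sum_form_smp[OF assms(1,2) spd_matrix_inv[OF assms(4)]]
    sum_form_smp[OF assms(1,3) spd_matrix_inv[OF assms(4)]]
  by (simp add: exp_add[symmetric] slope_def inner_add_left) (simp add: field_simps)

lemma joint_density_smp_rho:
  assumes "\<bar>\<rho>\<bar> < 1" "\<bar>\<rho>'\<bar> < 1" "\<bar>s\<bar> < 1" "snd z \<in> spd_matrices"
  shows "joint_density (smp \<rho>' s) (fst z) (snd z)
    = joint_density (smp \<rho> s) (fst z) (snd z) * exp ((\<rho>' - \<rho>) * tilt s z)"
  unfolding joint_density_eq sum_form_smp[OF assms(1,3) spd_matrix_inv[OF assms(4)]]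
    sum_form_smp[OF assms(2,3) spd_matrix_inv[OF assms(4)]]
  by (simp add: exp_add[symmetric] tilt_def) (simp add: field_simps)

lemma continuous_on_slope: "continuous_on (T \<times> spd_matrices) (slope \<rho>)"
proof -
  have "continuous_on (T \<times> spd_matrices) (\<lambda>z. matrix_inv (snd z))"
    by (rule continuous_on_matrix_inv) (auto intro!: continuous_intros spd_invertible)
  then show ?thesis unfolding slope_def[abs_def] by (intro continuous_intros) auto
qed

lemma continuous_on_smp: "continuous_on A (\<lambda>\<rho>. smp \<rho> s)"
  unfolding smp_def dev_def by (intro continuous_intros) auto

end

section \<open>Analytic continuation and convexity\<close>

text \<open>Termwise integration of the exponential series. The absolute terms sum to
  \<open>f z * exp \<bar>t * B z\<bar>\<close>, dominated by \<open>e\<close>, the sum of the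
  integrands at \<open>t\<close> and \<open>- t\<close>; both are integrable since the interval is
  symmetric.\<close>

lemma mgf_power_series:
  fixes f B :: "'a \<Rightarrow> real"
  assumes meas [measurable]: "f \<in> borel_measurable M" "B \<in> borel_measurable M"
    and pos: "\<And>z. z \<in> space M \<Longrightarrow> 0 \<le> f z"
    and int: "\<And>t. \<bar>t\<bar> < r \<Longrightarrow> integrable M (\<lambda>z. f z * exp (t * B z))"
    and t: "\<bar>t\<bar> < r"
  shows "(\<lambda>m. (\<integral>z. f z * B z ^ m / fact m \<partial>M) * t ^ m) sums (\<integral>z. f z * exp (t * B z) \<partial>M)"
proof -
  define h where "h m z = f z * ((t * B z) ^ m / fact m)" for m z
  define e where "e z = f z * exp (t * B z) + f z * exp (- t * B z)" for z
  have int_e: "integrable M e"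
    unfolding e_def using int[of t] int[of "- t"] t by (intro Bochner_Integration.integrable_add) auto
  have h_sums: "(\<lambda>m. h m z) sums (f z * exp (t * B z))" for z
    using sums_mult[OF exp_converges[of "t * B z"], of "f z"] by (simp add: h_def divide_inverse mult_ac)
  have abs_sums: "(\<lambda>m. norm (h m z)) sums (f z * exp \<bar>t * B z\<bar>)" if "z \<in> space M" for z
    using sums_mult[OF exp_converges[of "\<bar>t * B z\<bar>"], of "f z"] pos[OF that]
    by (simp add: h_def divide_inverse mult_ac abs_mult power_abs)
  have exp_abs: "f z * exp \<bar>t * B z\<bar> \<le> e z" if "z \<in> space M" for z
    using pos[OF that] by (cases "t * B z \<ge> 0") (auto simp: e_def)
  have partial: "(\<Sum>m\<in>I. norm (h m z)) \<le> e z" if "finite I" "z \<in> space M" for I z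
    using sum_le_suminf[OF sums_summable[OF abs_sums[OF that(2)]] that(1)] exp_abs[OF that(2)]
      sums_unique[OF abs_sums[OF that(2)]] by auto
  have [measurable]: "h m \<in> borel_measurable M" for m unfolding h_def by measurable
  have int_h: "integrable M (h m)" for m
    by (rule Bochner_Integration.integrable_bound[OF int_e])
      (use partial[of "{m}"] in \<open>auto intro!: AE_I2 order_trans[OF _ abs_ge_self]\<close>)
  have "(\<lambda>m. integral\<^sup>L M (h m)) sums (\<integral>z. (\<Sum>m. h m z) \<partial>M)"
  proof (rule sums_integral[OF int_h])
    show "AE z in M. summable (\<lambda>m. norm (h m z))"
      using abs_sums by (intro AE_I2) (auto simp: sums_iff)
    show "summable (\<lambda>m. \<integral>z. norm (h m z) \<partial>M)"
    proof (rule summableI_nonneg_bounded[where x = "integral\<^sup>L M e"])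
      fix N
      have "(\<Sum>m<N. \<integral>z. norm (h m z) \<partial>M) = (\<integral>z. (\<Sum>m<N. norm (h m z)) \<partial>M)"
        using int_h by (subst Bochner_Integration.integral_sum) auto
      also have "\<dots> \<le> integral\<^sup>L M e"
        using int_h partial by (intro integral_mono int_e) auto
      finally show "(\<Sum>m<N. \<integral>z. norm (h m z) \<partial>M) \<le> integral\<^sup>L M e" .
    qed simp
  qed
  moreover have "integral\<^sup>L M (h m) = (\<integral>z. f z * B z ^ m / fact m \<partial>M) * t ^ m" for m
  proof -
    have "h m = (\<lambda>z. (f z * B z ^ m / fact m) * t ^ m)"
      by (simp add: h_def fun_eq_iff power_mult_distrib mult_ac)
    then show ?thesis by (simp only: integral_mult_left_zero)
  qed
  moreover have "(\<Sum>m. h m z) = f z * exp (t * B z)" for z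
    using h_sums by (simp add: sums_iff)
  ultimately show ?thesis by simp
qed

text \<open>Identity theorem: a nonzero coefficient would make 0 an isolated zero of
  \<open>f\<close>.\<close>

lemma power_series_zero_extend:
  fixes a :: "nat \<Rightarrow> real"
  assumes sums: "\<And>t. \<bar>t\<bar> < r \<Longrightarrow> (\<lambda>m. a m * t ^ m) sums f t"
    and zero: "\<And>t. \<bar>t\<bar> < \<delta> \<Longrightarrow> f t = 0" and \<delta>: "0 < \<delta>" "\<delta> \<le> r" and t: "\<bar>t\<bar> < r"
  shows "f t = 0"
proof -
  have a0: "a 0 = 0"
    using sums[of 0] zero[of 0] \<delta> by simp
  have "a m = 0" for m
  proof (rule ccontr)
    assume m: "a m \<noteq> 0"
    then have "m > 0" using a0 by (cases m) auto
    obtain s where s: "s > 0" "\<And>z. z \<in> cball 0 s - {0} \<Longrightarrow> f z \<noteq> 0"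
      using powser_0_nonzero[of r 0 a f m] sums zero[of 0] m \<open>m > 0\<close> \<delta> by auto
    have "f (min s (\<delta> / 2)) \<noteq> 0" using s(1) \<delta> by (intro s(2)) auto
    with zero[of "min s (\<delta> / 2)"] s(1) \<delta>(1) show False by (auto simp: min_def split: if_splits)
  qed
  with sums[OF t] show ?thesis by (simp add: sums_iff)
qed

text \<open>The equality case of strict convexity of the exponential: the second difference
  \<open>k\<close> is \<open>f\<close> times a square, and its integral is at most 0.\<close>

lemma exp_convexity_AE_zero:
  fixes f D :: "'a \<Rightarrow> real"
  assumes pos: "\<And>z. z \<in> space M \<Longrightarrow> 0 < f z" and \<eta>: "\<eta> \<noteq> 0"
    and int: "integrable M f" "integrable M (\<lambda>z. f z * exp (\<eta> * D z))" "integrable M (\<lambda>z. f z * exp (- \<eta> * D z))"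
    and le: "(\<integral>z. f z * exp (\<eta> * D z) \<partial>M) + (\<integral>z. f z * exp (- \<eta> * D z) \<partial>M) \<le> 2 * (\<integral>z. f z \<partial>M)"
  shows "AE z in M. D z = 0"
proof -
  define k where "k z = f z * exp (\<eta> * D z) + f z * exp (- \<eta> * D z) - 2 * f z" for z
  have k_eq: "k z = f z * (exp (\<eta> * D z / 2) - exp (- (\<eta> * D z / 2)))\<^sup>2" for z
  proof -
    have "exp (\<eta> * D z) = exp (\<eta> * D z / 2) * exp (\<eta> * D z / 2)"
      "exp (- \<eta> * D z) = exp (- (\<eta> * D z / 2)) * exp (- (\<eta> * D z / 2))"
      "exp (\<eta> * D z / 2) * exp (- (\<eta> * D z / 2)) = 1"
      by (simp_all add: exp_add[symmetric])
    then show ?thesis by (simp add: k_def power2_eq_square algebra_simps)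
  qed
  have int_k: "integrable M k" unfolding k_def using int by auto
  have nonneg: "AE z in M. 0 \<le> k z" using pos by (intro AE_I2) (auto simp: k_eq less_imp_le)
  have "integral\<^sup>L M k \<le> 0" unfolding k_def using le int by simp
  then have "integral\<^sup>L M k = 0" using integral_nonneg_AE[OF nonneg] by simp
  then have "AE z in M. k z = 0" using integral_nonneg_eq_0_iff_AE[OF int_k nonneg] by simp
  then show ?thesis
  proof (rule AE_mp[OF _ AE_I2], intro impI)
    fix z assume "z \<in> space M" "k z = 0"
    then have "exp (\<eta> * D z / 2) = exp (- (\<eta> * D z / 2))" using pos[of z] by (simp add: k_eq)
    then show "D z = 0" using \<eta> by simp
  qed
qed

lemma continuous_on_hotelling: "continuous_on regular_samples (hotelling :: real^'p^'n \<Rightarrow> real)"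
proof -
  have "continuous_on regular_samples (\<lambda>x :: real^'p^'n. matrix_inv (sample_cov x))"
    by (rule continuous_on_matrix_inv[OF continuous_on_sample_cov])
      (auto simp: regular_samples_def intro: spd_invertible)
  then show ?thesis
    unfolding hotelling_def[abs_def] inner_wrt_def by (intro continuous_intros)
qed

lemma open_less_regular:
  fixes f :: "real^'p^'n \<Rightarrow> real"
  assumes "continuous_on regular_samples f"
  shows "open {x \<in> regular_samples. f x < a}"
proof -
  have "open (f -` {..<a} \<inter> regular_samples)"
    by (intro continuous_on_open_vimage[THEN iffD1, rule_format] assms open_regular_samples open_lessThan)
  moreover have "f -` {..<a} \<inter> regular_samples = {x \<in> regular_samples. f x < a}" by auto
  ultimately show ?thesis by simp
qed

section \<open>Marginal densities along the family\<close>

context sample_family begin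

lemma continuous_on_marginal_smp:
  assumes G: "prior G T" and s: "\<bar>s\<bar> < 1"
  shows "continuous_on {-1<..<1} (\<lambda>\<rho>. marginal G (smp \<rho> s))"
  by (rule continuous_on_compose2[OF prior.continuous_on_marginal[OF G n] continuous_on_smp])
    (use smp_regular s in \<open>auto simp: abs_less_iff\<close>)

lemma integrable_smp:
  assumes G: "prior G T" and "\<bar>\<rho>\<bar> < 1" "\<bar>s\<bar> < 1"
  shows "integrable G (\<lambda>z. joint_density (smp \<rho> s) (fst z) (snd z))"
  by (intro prior.integrable_joint_density[OF G] smp_regular n assms)

text \<open>In \<open>s\<close> the marginal is a moment generating function of
  \<open>slope \<rho>\<close>. The disc with centre \<open>1/4\<close> and radius \<open>3/4\<close>
  meets the real line in \<open>(-1/2, 1)\<close>: it is centred among positive \<open>s\<close> and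
  still reaches negative ones.\<close>

lemma marginal_smp_power_series:
  assumes G: "prior G T" and \<rho>: "\<bar>\<rho>\<bar> < 1"
  obtains a where "\<And>t. \<bar>t\<bar> < 3/4 \<Longrightarrow> (\<lambda>m. a m * t ^ m) sums marginal G (smp \<rho> (1/4 + t))"
proof -
  define f where "f z = joint_density (smp \<rho> (1/4)) (fst z) (snd z)" for z
  have eq: "joint_density (smp \<rho> (1/4 + t)) (fst z) (snd z) = f z * exp (t * slope \<rho> z)"
    if "\<bar>t\<bar> < 3/4" "z \<in> space G" for t z
  proof -
    have "\<bar>1/4 + t\<bar> < 1" using that(1) by linarith
    moreover have "snd z \<in> spd_matrices"
      using that(2) unfolding prior.space_G[OF G] by (simp add: mem_Times_iff)
    ultimately show ?thesis
      using joint_density_smp_s[OF \<rho>, of "1/4" "1/4 + t" z] by (simp add: f_def)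
  qed
  have sums: "(\<lambda>m. (\<integral>z. f z * slope \<rho> z ^ m / fact m \<partial>G) * t ^ m) sums (\<integral>z. f z * exp (t * slope \<rho> z) \<partial>G)"
    if "\<bar>t\<bar> < 3/4" for t
  proof (rule mgf_power_series[where r = "3/4"])
    show "f \<in> borel_measurable G" unfolding f_def by (rule prior.measurable_joint_density[OF G])
    show "slope \<rho> \<in> borel_measurable G"
      by (rule prior.measurable_continuous_on[OF G continuous_on_slope])
    show "0 \<le> f z" if "z \<in> space G" for z
      using that prior.space_G[OF G] by (auto simp: f_def intro: less_imp_le[OF joint_density_pos])
    show "integrable G (\<lambda>z. f z * exp (t * slope \<rho> z))" if "\<bar>t\<bar> < 3/4" for t
    proof -
      have "integrable G (\<lambda>z. joint_density (smp \<rho> (1/4 + t)) (fst z) (snd z))"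
        using that by (intro integrable_smp[OF G \<rho>]) linarith
      also have "?this \<longleftrightarrow> ?thesis"
        by (intro Bochner_Integration.integrable_cong refl eq that)
      finally show ?thesis .
    qed
  qed fact
  have integral: "(\<integral>z. f z * exp (t * slope \<rho> z) \<partial>G) = marginal G (smp \<rho> (1/4 + t))" if "\<bar>t\<bar> < 3/4" for t
    unfolding marginal_def by (rule sym, intro Bochner_Integration.integral_cong refl eq that)
  show thesis
    by (rule that[of "\<lambda>m. \<integral>z. f z * slope \<rho> z ^ m / fact m \<partial>G"]) (use sums integral in simp)
qed

text \<open>For \<open>\<theta> = 0\<close> the derivative \<open>tilt\<close> vanishes, so the
  density does not change with \<open>\<rho>\<close>.\<close>

lemma marginal_null_smp:
  assumes G0: "prior G0 {0}" and "\<bar>\<rho>\<bar> < 1" "\<bar>\<rho>'\<bar> < 1" "\<bar>s\<bar> < 1"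
  shows "marginal G0 (smp \<rho> s) = marginal G0 (smp \<rho>' s)"
  unfolding marginal_def
proof (rule Bochner_Integration.integral_cong[OF refl])
  fix z assume "z \<in> space G0"
  then have z: "fst z = 0" "snd z \<in> spd_matrices"
    unfolding prior.space_G[OF G0] by (simp_all add: mem_Times_iff)
  then show "joint_density (smp \<rho> s) (fst z) (snd z) = joint_density (smp \<rho>' s) (fst z) (snd z)"
    unfolding joint_density_smp_rho[OF assms(3,2,4) z(2)] by (simp add: tilt_def z(1))
qed

text \<open>The argument runs in the coordinates \<open>\<rho>\<close> and \<open>s\<close>, where
  Hotelling's statistic becomes the function \<open>h\<close> of \<open>\<rho>\<close> alone,
  increasing on \<open>(0, 1)\<close>.\<close>

lemma tilt_AE_zero:
  fixes C :: "(real^'p) set"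
  assumes C: "closed C" "C \<noteq> {}" "\<And>t y. 0 \<le> t \<Longrightarrow> y \<in> C \<Longrightarrow> t *\<^sub>R y \<in> C"
    and C_le: "\<And>y. y \<in> C \<Longrightarrow> 0 \<le> y $ l" and C_ge: "\<And>y. (\<And>k. 0 < y $ k) \<Longrightarrow> y \<in> C"
    and G0: "prior G0 {0}" and G1: "prior G1 T1" and c: "c > 0" and u: "u > 0"
    and bayes: "AE x in lborel.
           let m0 = (\<integral>\<^sup>+ (\<theta>, \<Sigma>). ennreal (joint_density x \<theta> \<Sigma>) \<partial>G0);
               m1 = (\<integral>\<^sup>+ (\<theta>, \<Sigma>). ennreal (joint_density x \<theta> \<Sigma>) \<partial>G1)
           in (m1 > ennreal c * m0 \<longrightarrow> x \<notin> {x :: real^'p^'n. uit_stat C x \<le> u})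
            \<and> (m1 < ennreal c * m0 \<longrightarrow> x \<in> {x. uit_stat C x \<le> u})"
    and s: "-1/2 < s" "s < 0"
  shows "AE z in G1. tilt s z = 0"
proof -
  define N where "N = real CARD('n) - 1"
  have N: "N > 0" using n by (simp add: N_def)
  define M1 where "M1 \<rho> s = marginal G1 (smp \<rho> s)" for \<rho> s
  define M0 where "M0 \<rho> s = c * marginal G0 (smp \<rho> s)" for \<rho> s
  define h where "h \<rho> = N * \<rho>\<^sup>2 / (1 - \<rho>\<^sup>2)" for \<rho> :: real
  \<comment> \<open>The positive solution of \<open>h \<rho> = u\<close>.\<close>
  define \<rho>0 where "\<rho>0 = sqrt (u / (N + u))"
  have \<rho>0: "0 < \<rho>0" "\<rho>0 < 1" using u N by (auto simp: \<rho>0_def)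
  have \<rho>0_sq: "\<rho>0\<^sup>2 * (N + u) = u" using u N by (simp add: \<rho>0_def)
  have sq_less1: "\<rho>\<^sup>2 < 1" if "0 < \<rho>" "\<rho> < 1" for \<rho> :: real
    using that by (simp add: power_less_one_iff)
  have h_less: "h \<rho> < u \<longleftrightarrow> \<rho> < \<rho>0" and h_greater: "u < h \<rho> \<longleftrightarrow> \<rho>0 < \<rho>" if "0 < \<rho>" "\<rho> < 1" for \<rho>
  proof -
    have Nu: "N + u > 0" using N u by simp
    have "h \<rho> < u \<longleftrightarrow> \<rho>\<^sup>2 * (N + u) < \<rho>0\<^sup>2 * (N + u)" "u < h \<rho> \<longleftrightarrow> \<rho>0\<^sup>2 * (N + u) < \<rho>\<^sup>2 * (N + u)"
      unfolding \<rho>0_sq using sq_less1[OF that] by (auto simp: h_def field_simps)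
    moreover have "\<rho>\<^sup>2 < \<rho>0\<^sup>2 \<longleftrightarrow> \<rho> < \<rho>0" "\<rho>0\<^sup>2 < \<rho>\<^sup>2 \<longleftrightarrow> \<rho>0 < \<rho>"
      using that \<rho>0 by (auto simp: power_mono_iff less_le)
    ultimately show "h \<rho> < u \<longleftrightarrow> \<rho> < \<rho>0" "u < h \<rho> \<longleftrightarrow> \<rho>0 < \<rho>"
      using Nu by auto
  qed
  note sign = marginal_sign[OF n G0 G1 c bayes]
  have reg: "sample_cov x \<in> spd_matrices" if "x \<in> regular_samples" for x :: "real^'p^'n"
    using that by (simp add: regular_samples_def)
  have U_le: "uit_stat C x \<le> hotelling x" if "x \<in> regular_samples" for x :: "real^'p^'n"
    by (rule uit_stat_le_hotelling[OF reg[OF that] C(1,2)]) (rule C(3))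
  have U_eq: "uit_stat C x = hotelling x" if "x \<in> regular_samples" "sample_mean x \<in> C" for x :: "real^'p^'n"
    by (rule uit_stat_eq_hotelling[OF reg[OF that(1)] C(1,2) _ that(2)]) (rule C(3))
  have U_half: "uit_stat C x \<le> hotelling x - real CARD('n) * (sample_mean x $ l)\<^sup>2 / sample_cov x $ l $ l"
    if "x \<in> regular_samples" "sample_mean x $ l < 0" for x :: "real^'p^'n"
    by (rule uit_stat_le_half_space[OF reg[OF that(1)] C(1,2) _ _ that(2)]) (rule C(3) C_le, assumption+)+
  \<comment> \<open>Hotelling's statistic is below \<open>u\<close> and dominates the test
    statistic, so a whole neighbourhood is accepted.\<close>
  have inside: "M1 \<rho> s \<le> M0 \<rho> s" if "0 < \<rho>" "\<rho> < \<rho>0" "\<bar>s\<bar> < 1" for \<rho> s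
  proof -
    let ?W = "{x :: real^'p^'n. x \<in> regular_samples \<and> hotelling x < u}"
    have "smp \<rho> s \<in> ?W"
      using that \<rho>0 h_less[of \<rho>] smp_regular[of \<rho> s] hotelling_smp[of \<rho> s] by (auto simp: h_def N_def)
    moreover have "?W \<subseteq> {x. uit_stat C x \<le> u}"
      using U_le by (auto intro: order_trans less_imp_le)
    moreover have "open ?W" by (rule open_less_regular[OF continuous_on_hotelling])
    moreover have "?W \<subseteq> regular_samples" by blast
    ultimately show ?thesis
      unfolding M1_def M0_def by (intro sign(1))
  qed
  \<comment> \<open>For positive \<open>s\<close> the mean has positive coordinates, so the two
    statistics coincide nearby and a neighbourhood is rejected.\<close>
  have outside: "M0 \<rho> s \<le> M1 \<rho> s" if "\<rho>0 < \<rho>" "\<rho> < 1" "0 < s" "s < 1" for \<rho> s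
  proof -
    let ?W = "{x :: real^'p^'n. x \<in> regular_samples \<and> - hotelling x < - u} \<inter> {x. \<forall>k. 0 < sample_mean x $ k}"
    have "{x :: real^'p^'n. \<forall>k. 0 < sample_mean x $ k} = (\<Inter>k. {x. 0 < sample_mean x $ k})" by auto
    then have "open {x :: real^'p^'n. \<forall>k. 0 < sample_mean x $ k}"
      by (auto intro!: open_INT open_Collect_less continuous_intros)
    then have "open ?W"
      by (intro open_Int open_less_regular continuous_intros continuous_on_hotelling)
    moreover have "smp \<rho> s \<in> ?W"
    proof -
      have "0 < \<rho>" using \<rho>0 that by simp
      moreover have "0 < wt s $ k" for k using that w0_pos by (simp add: wt_def)
      ultimately show ?thesis
        using that \<rho>0 h_greater[of \<rho>] smp_regular[of \<rho> s] hotelling_smp[of \<rho> s]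
        by (auto simp: h_def N_def sample_mean_smp)
    qed
    moreover have "?W \<inter> {x. uit_stat C x \<le> u} = {}"
      using U_eq[OF _ C_ge] by auto
    moreover have "?W \<subseteq> regular_samples" by blast
    ultimately show ?thesis
      unfolding M1_def M0_def by (intro sign(2))
  qed
  \<comment> \<open>For negative \<open>s\<close> the half-space estimate lowers the statistic by at
    least \<open>N * (\<rho>\<^sup>2 * s\<^sup>2)\<close>, which extends acceptance slightly beyond
    \<open>\<rho>0\<close>.\<close>
  have corner: "M1 \<rho> s \<le> M0 \<rho> s" if "0 < \<rho>" "\<rho> < 1" "\<bar>s\<bar> < 1" "s < 0" "h \<rho> - N * (\<rho>\<^sup>2 * s\<^sup>2) < u" for \<rho> s
  proof -
    let ?f = "\<lambda>x :: real^'p^'n. hotelling x - real CARD('n) * (sample_mean x $ l)\<^sup>2 / sample_cov x $ l $ l"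
    let ?W = "{x :: real^'p^'n. x \<in> regular_samples \<and> ?f x < u} \<inter> {x. sample_mean x $ l < 0}"
    have "sample_cov x $ l $ l \<noteq> 0" if "x \<in> regular_samples" for x :: "real^'p^'n"
      using spd_pos[OF reg[OF that], of "axis l 1"] by (auto simp: form_axis)
    then have "open ?W"
      by (intro open_Int open_less_regular continuous_intros continuous_on_hotelling open_Collect_less) auto
    moreover have "smp \<rho> s \<in> ?W"
    proof -
      have S: "0 < sample_cov (smp \<rho> s) $ l $ l" "sample_cov (smp \<rho> s) $ l $ l \<le> 1 / N"
        using sample_cov_smp_l[of \<rho> s] that by (auto simp: N_def)
      have "N * (\<rho>\<^sup>2 * s\<^sup>2) = (\<rho>\<^sup>2 * s\<^sup>2) / (1 / N)" by simp
      also have "\<dots> \<le> (\<rho>\<^sup>2 * s\<^sup>2) / sample_cov (smp \<rho> s) $ l $ l"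
        using S N by (intro divide_left_mono) auto
      finally have le: "N * (\<rho>\<^sup>2 * s\<^sup>2) \<le> (\<rho>\<^sup>2 * s\<^sup>2) / sample_cov (smp \<rho> s) $ l $ l" .
      have "real CARD('n) * (sample_mean (smp \<rho> s) $ l)\<^sup>2 = \<rho>\<^sup>2 * s\<^sup>2"
        by (simp add: sample_mean_smp wt_l power_mult_distrib power_divide)
      moreover have "hotelling (smp \<rho> s) = h \<rho>"
        using that hotelling_smp[of \<rho> s] by (simp add: h_def N_def)
      ultimately have "?f (smp \<rho> s) < u" using le that(5) by simp
      moreover have "sample_mean (smp \<rho> s) $ l < 0"
        using that by (simp add: sample_mean_smp wt_l mult_pos_neg divide_neg_pos)
      moreover have "smp \<rho> s \<in> regular_samples" using that by (intro smp_regular) auto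
      ultimately show ?thesis by blast
    qed
    moreover have "?W \<subseteq> {x. uit_stat C x \<le> u}"
      using U_half by (auto intro: order_trans less_imp_le)
    moreover have "?W \<subseteq> regular_samples" by blast
    ultimately show ?thesis
      unfolding M1_def M0_def by (intro sign(1))
  qed
  \<comment> \<open>The inequalities \<open>inside\<close> and \<open>outside\<close> meet in the
    limit as \<open>\<rho>\<close> tends to \<open>\<rho>0\<close> from either side.\<close>
  have on_pos: "M1 \<rho>0 s = M0 \<rho>0 s" if "0 < s" "s < 1" for s
  proof -
    have "continuous_on {-1<..<1} (\<lambda>\<rho>. M1 \<rho> s - M0 \<rho> s)"
      unfolding M1_def M0_def using that
      by (intro continuous_intros continuous_on_marginal_smp[OF G0] continuous_on_marginal_smp[OF G1]) auto
    then have lim: "((\<lambda>\<rho>. M1 \<rho> s - M0 \<rho> s) \<longlongrightarrow> M1 \<rho>0 s - M0 \<rho>0 s) (at \<rho>0)"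
      using \<rho>0 by (auto simp: continuous_on_eq_continuous_at isCont_def)
    have "\<forall>\<^sub>F \<rho> in at_left \<rho>0. M1 \<rho> s - M0 \<rho> s \<le> 0"
      unfolding eventually_at_left[OF \<rho>0(1)] using inside that by (intro exI[of _ 0]) (auto simp: \<rho>0)
    then have "M1 \<rho>0 s - M0 \<rho>0 s \<le> 0"
      by (intro tendsto_upperbound[OF filterlim_mono[OF lim order_refl at_le]]) auto
    moreover have "\<forall>\<^sub>F \<rho> in at_right \<rho>0. 0 \<le> M1 \<rho> s - M0 \<rho> s"
      unfolding eventually_at_right[OF \<rho>0(2)] using outside that by (intro exI[of _ 1]) (auto simp: \<rho>0)
    then have "0 \<le> M1 \<rho>0 s - M0 \<rho>0 s"
      by (intro tendsto_lowerbound[OF filterlim_mono[OF lim order_refl at_le]]) auto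
    ultimately show ?thesis by simp
  qed
  have \<rho>0_abs: "\<bar>\<rho>0\<bar> < 1" using \<rho>0 by simp
  have on_sphere: "M1 \<rho>0 s = M0 \<rho>0 s"
  proof -
    obtain a1 where a1: "\<And>t. \<bar>t\<bar> < 3/4 \<Longrightarrow> (\<lambda>m. a1 m * t ^ m) sums marginal G1 (smp \<rho>0 (1/4 + t))"
      using marginal_smp_power_series[OF G1 \<rho>0_abs] by blast
    obtain a0 where a0: "\<And>t. \<bar>t\<bar> < 3/4 \<Longrightarrow> (\<lambda>m. a0 m * t ^ m) sums marginal G0 (smp \<rho>0 (1/4 + t))"
      using marginal_smp_power_series[OF G0 \<rho>0_abs] by blast
    \<comment> \<open>For \<open>\<bar>t\<bar> < 1/4\<close> the point \<open>1/4 + t\<close> is in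
      \<open>(0, 1/2)\<close>, where \<open>on_pos\<close> applies; the fixed negative
      \<open>s\<close> is within \<open>3/4\<close> of the centre because
      \<open>-1/2 < s\<close>.\<close>
    have "M1 \<rho>0 (1/4 + (s - 1/4)) - M0 \<rho>0 (1/4 + (s - 1/4)) = 0"
    proof (rule power_series_zero_extend[where r = "3/4" and \<delta> = "1/4" and a = "\<lambda>m. a1 m - c * a0 m"
          and f = "\<lambda>t. M1 \<rho>0 (1/4 + t) - M0 \<rho>0 (1/4 + t)"])
      fix t :: real assume "\<bar>t\<bar> < 3/4"
      from sums_diff[OF a1[OF this] sums_mult[OF a0[OF this], of c]]
      show "(\<lambda>m. (a1 m - c * a0 m) * t ^ m) sums (M1 \<rho>0 (1/4 + t) - M0 \<rho>0 (1/4 + t))"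
        by (simp add: M1_def M0_def algebra_simps)
    next
      fix t :: real assume "\<bar>t\<bar> < 1/4"
      then show "M1 \<rho>0 (1/4 + t) - M0 \<rho>0 (1/4 + t) = 0" using on_pos[of "1/4 + t"] by auto
    qed (use s in auto)
    then show ?thesis by simp
  qed
  \<comment> \<open>At \<open>\<eta> = 0\<close> the last inequality is strict since
    \<open>h \<rho>0 = u\<close> and \<open>s\<close> is nonzero; continuity leaves room for a
    positive \<open>\<eta>\<close>.\<close>
  obtain \<eta> where \<eta>: "0 < \<eta>" "\<eta> < \<rho>0" "\<rho>0 + \<eta> < 1" "h (\<rho>0 + \<eta>) - N * ((\<rho>0 + \<eta>)\<^sup>2 * s\<^sup>2) < u"
  proof -
    have h0: "h \<rho>0 = u"
      using \<rho>0_sq sq_less1[OF \<rho>0] by (simp add: h_def field_simps)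
    have "((\<lambda>\<eta>. h (\<rho>0 + \<eta>) - N * ((\<rho>0 + \<eta>)\<^sup>2 * s\<^sup>2)) \<longlongrightarrow> h (\<rho>0 + 0) - N * ((\<rho>0 + 0)\<^sup>2 * s\<^sup>2)) (at_right 0)"
      unfolding h_def using sq_less1[OF \<rho>0] by (intro tendsto_intros) auto
    moreover have "h (\<rho>0 + 0) - N * ((\<rho>0 + 0)\<^sup>2 * s\<^sup>2) < u"
      using N \<rho>0 s by (simp add: h0)
    ultimately have "\<forall>\<^sub>F \<eta> in at_right 0. h (\<rho>0 + \<eta>) - N * ((\<rho>0 + \<eta>)\<^sup>2 * s\<^sup>2) < u"
      by (rule order_tendstoD)
    moreover have "\<forall>\<^sub>F \<eta> in at_right 0. \<eta> \<in> {0<..<min \<rho>0 (1 - \<rho>0)}"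
      using \<rho>0 by (intro eventually_at_right_real) auto
    ultimately have "\<forall>\<^sub>F \<eta> in at_right 0. 0 < \<eta> \<and> \<eta> < \<rho>0 \<and> \<rho>0 + \<eta> < 1 \<and> h (\<rho>0 + \<eta>) - N * ((\<rho>0 + \<eta>)\<^sup>2 * s\<^sup>2) < u"
      by eventually_elim auto
    from eventually_happens'[OF trivial_limit_at_right_real this] show thesis using that by auto
  qed
  have s1: "\<bar>s\<bar> < 1" using s by linarith
  define f where "f z = joint_density (smp \<rho>0 s) (fst z) (snd z)" for z
  have f_eq: "joint_density (smp (\<rho>0 + t) s) (fst z) (snd z) = f z * exp (t * tilt s z)"
    if "z \<in> space G1" "\<bar>\<rho>0 + t\<bar> < 1" for z t
  proof -
    have "snd z \<in> spd_matrices" using that(1) unfolding prior.space_G[OF G1] by (simp add: mem_Times_iff)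
    from joint_density_smp_rho[OF \<rho>0_abs that(2) s1 this] show ?thesis by (simp add: f_def)
  qed
  have int: "integrable G1 (\<lambda>z. f z * exp (t * tilt s z))" and
    int_eq: "(\<integral>z. f z * exp (t * tilt s z) \<partial>G1) = M1 (\<rho>0 + t) s" if "\<bar>\<rho>0 + t\<bar> < 1" for t
  proof -
    have "integrable G1 (\<lambda>z. joint_density (smp (\<rho>0 + t) s) (fst z) (snd z))"
      by (intro integrable_smp[OF G1] that s1)
    also have "?this \<longleftrightarrow> integrable G1 (\<lambda>z. f z * exp (t * tilt s z))"
      by (intro Bochner_Integration.integrable_cong refl f_eq that)
    finally show "integrable G1 (\<lambda>z. f z * exp (t * tilt s z))" .
    show "(\<integral>z. f z * exp (t * tilt s z) \<partial>G1) = M1 (\<rho>0 + t) s"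
      unfolding M1_def marginal_def by (rule sym, intro Bochner_Integration.integral_cong refl f_eq that)
  qed
  show ?thesis
  proof (rule exp_convexity_AE_zero[of G1 f \<eta>])
    show "0 < f z" if "z \<in> space G1" for z
      using that prior.space_G[OF G1] by (auto simp: f_def intro: joint_density_pos)
    show "integrable G1 f" using int[of 0] \<rho>0 by simp
    \<comment> \<open>Both right-hand sides equal \<open>M0 \<rho>0 s\<close>, which is
      \<open>M1 \<rho>0 s\<close>, so the sum of the inequalities is midpoint convexity
      reversed.\<close>
    have "M1 (\<rho>0 + \<eta>) s \<le> M0 (\<rho>0 + \<eta>) s" "M1 (\<rho>0 - \<eta>) s \<le> M0 (\<rho>0 - \<eta>) s"
      using \<eta> \<rho>0 s s1 by (simp_all add: corner inside)
    moreover have "M0 (\<rho>0 + \<eta>) s = M0 \<rho>0 s" "M0 (\<rho>0 - \<eta>) s = M0 \<rho>0 s"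
      unfolding M0_def using \<eta> \<rho>0
      by (intro arg_cong[where f = "\<lambda>x. c * x"] marginal_null_smp[OF G0 _ \<rho>0_abs s1]; simp)+
    moreover have "(\<integral>z. f z \<partial>G1) = M1 \<rho>0 s" using int_eq[of 0] \<rho>0 by simp
    ultimately show "(\<integral>z. f z * exp (\<eta> * tilt s z) \<partial>G1) + (\<integral>z. f z * exp (- \<eta> * tilt s z) \<partial>G1) \<le> 2 * (\<integral>z. f z \<partial>G1)"
      using int_eq[of \<eta>] int_eq[of "- \<eta>"] \<eta> \<rho>0 on_sphere by simp
    show "integrable G1 (\<lambda>z. f z * exp (\<eta> * tilt s z))" "integrable G1 (\<lambda>z. f z * exp (- \<eta> * tilt s z))"
      using int[of \<eta>] int[of "- \<eta>"] \<eta> \<rho>0 by simp_all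
    show "\<eta> \<noteq> 0" using \<eta>(1) by simp
  qed
qed

end

section \<open>Enough directions to determine the mean parameter\<close>

lemma (in sample_family) tilt_eq_0_iff:
  "tilt s z = 0 \<longleftrightarrow> (\<Sum>k\<in>UNIV. (if k = l then s else w0 k) * (matrix_inv (snd z) *v fst z) $ k) = 0"
  by (simp add: tilt_def inner_vec_def wt_def)

text \<open>The conditions on \<open>C\<close> capture what the orthant and the half-space share: a
  closed cone between the open orthant and the half-space given by coordinate
  \<open>l\<close>.\<close>

lemma not_proper_Bayes_test_uit:
  fixes C :: "(real^'p) set"
  assumes C: "closed C" "0 \<in> C" "\<And>t y. 0 \<le> t \<Longrightarrow> y \<in> C \<Longrightarrow> t *\<^sub>R y \<in> C"
    and C_le: "\<And>y. y \<in> C \<Longrightarrow> 0 \<le> y $ l" and C_ge: "\<And>y. (\<And>k. 0 < y $ k) \<Longrightarrow> y \<in> C"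
    and jl: "j \<noteq> l" and n: "CARD('n) > CARD('p)" and u: "u > 0"
  shows "\<not> proper_Bayes_test C {x :: real^'p^'n. uit_stat C x \<le> u}"
proof
  assume "proper_Bayes_test C {x :: real ^ 'p ^ 'n. uit_stat C x \<le> u}"
  then obtain G0 G1 c where
    G: "prob_space G0" "sets G0 = sets (restrict_space borel ({0} \<times> spd_matrices))"
       "prob_space G1" "sets G1 = sets (restrict_space borel ((C - {0}) \<times> spd_matrices))"
    and c: "c > 0"
    and bayes: "AE x in lborel.
           let m0 = (\<integral>\<^sup>+ (\<theta>, \<Sigma>). ennreal (joint_density x \<theta> \<Sigma>) \<partial>G0);
               m1 = (\<integral>\<^sup>+ (\<theta>, \<Sigma>). ennreal (joint_density x \<theta> \<Sigma>) \<partial>G1)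
           in (m1 > ennreal c * m0 \<longrightarrow> x \<notin> {x :: real^'p^'n. uit_stat C x \<le> u})
            \<and> (m1 < ennreal c * m0 \<longrightarrow> x \<in> {x. uit_stat C x \<le> u})"
    unfolding proper_Bayes_test_def by blast
  have G0: "prior G0 {0}" and G1: "prior G1 (C - {0})"
    using G by (simp_all add: prior_def prior_axioms_def)
  have "card {j, l} \<le> CARD('p)" by (rule card_mono) auto
  then have n1: "CARD('n) > 1" using jl n by simp
  obtain g :: "'p \<Rightarrow> real^'n" where g: "\<And>k k'. (\<Sum>i\<in>UNIV. g k $ i * g k' $ i) = (if k = k' then 1 else 0)"
      "\<And>k. (\<Sum>i\<in>UNIV. g k $ i) = 0"
    using orthonormal_centered_vectors[OF n] by blast
  \<comment> \<open>Doubling one weight at a time separates the coordinates; the weight at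
    \<open>j\<close> stays 1, as \<open>sample_family\<close> demands, so \<open>w j\<close> is
    constantly 1.\<close>
  define w where "w k0 k = (if k = k0 \<and> k \<noteq> j then 2 else 1 :: real)" for k0 k
  define a where "a z = matrix_inv (snd z) *v fst z" for z :: "(real^'p) \<times> (real^'p^'p)"
  have dir: "AE z in G1. (\<Sum>k\<in>UNIV. (if k = l then s else w k0 k) * a z $ k) = 0" if s: "-1/2 < s" "s < 0" for s k0
  proof -
    interpret sample_family g j l "w k0"
      by unfold_locales (use jl g n1 in \<open>auto simp: w_def\<close>)
    have "C \<noteq> {}" using C(2) by blast
    from tilt_AE_zero[OF C(1) this C(3) C_le C_ge G0 G1 c u bayes s] show ?thesis
      unfolding tilt_eq_0_iff a_def .
  qed
  \<comment> \<open>The index \<open>k0\<close> ranges over a finite type, so one null set serves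
    all of them.\<close>
  have dirs: "AE z in G1. \<forall>k0. (\<Sum>k\<in>UNIV. (if k = l then s else w k0 k) * a z $ k) = 0" if s: "-1/2 < s" "s < 0" for s
    using dir[OF s] by (simp add: AE_all_countable)
  \<comment> \<open>Any two values of \<open>s\<close> in \<open>(-1/2, 0)\<close> would do;
    subtracting the two equations isolates coordinate \<open>l\<close>.\<close>
  have s: "- 1/2 < (- 1/4 :: real)" "(- 1/4 :: real) < 0" "- 1/2 < (- 1/8 :: real)" "(- 1/8 :: real) < 0"
    by simp_all
  have "AE z in G1. a z = 0"
    using dirs[OF s(1,2)] dirs[OF s(3,4)]
  proof eventually_elim
    case (elim z)
    define R where "R k0 = (\<Sum>k\<in>UNIV - {l}. w k0 k * a z $ k)" for k0
    have split: "(\<Sum>k\<in>UNIV. (if k = l then s else w k0 k) * a z $ k) = s * a z $ l + R k0" for s k0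
      by (subst sum.remove[of _ l]) (auto simp: R_def intro!: sum.cong)
    have *: "-1/4 * a z $ l + R k0 = 0" "-1/8 * a z $ l + R k0 = 0" for k0
      using elim unfolding split by blast+
    have l: "a z $ l = 0" using *[of j] by simp
    have R: "R k0 = 0" for k0 using *(1)[of k0] l by simp
    have other: "a z $ k = 0" if "k \<noteq> j" for k
    proof (cases "k = l")
      case False
      \<comment> \<open>Doubling the weight at \<open>k\<close> changes the sum by exactly
        \<open>a z $ k\<close>.\<close>
      have "R k - R j = (\<Sum>k'\<in>UNIV - {l}. if k' = k then a z $ k' else 0)"
        unfolding R_def sum_subtractf[symmetric] using that by (intro sum.cong) (auto simp: w_def)
      with False show ?thesis by (simp add: R)
    qed (simp add: l)
    have "R j = (\<Sum>k\<in>UNIV - {l}. if k = j then a z $ k else 0)"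
      unfolding R_def by (intro sum.cong) (auto simp: w_def other)
    then have "a z $ j = 0" using jl by (simp add: R)
    with other have "a z $ k = 0" for k by (cases "k = j") auto
    then show ?case by (simp add: vec_eq_iff)
  qed
  then have "AE z in G1. False"
  proof (rule AE_mp[OF _ AE_I2], intro impI)
    fix z assume "z \<in> space G1" and az: "a z = 0"
    then have z: "fst z \<noteq> 0" "snd z \<in> spd_matrices"
      unfolding prior.space_G[OF G1] by (simp_all add: mem_Times_iff)
    have "fst z = snd z *v a z" unfolding a_def by (simp add: matrix_inv_cancel[OF spd_invertible[OF z(2)]])
    with az z(1) show False by simp
  qed
  then show False using prob_space.AE_const[OF G(3)] by simp
qed

theorem theorem3p1:
  fixes C :: "(real ^ 'p :: {finite, linorder}) set"
    and \<alpha> u :: real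
  assumes "CARD('p :: {finite, linorder}) \<ge> 2"
    and "CARD('n :: finite) > CARD('p :: {finite, linorder})"
    and "C = pos_orthant \<or> C = last_half_space"
    and "0 < \<alpha>" and "\<alpha> < 1"
    and "u > 0"
    and "(SUP \<Sigma>\<in>spd_matrices. measure (sample_law 0 \<Sigma>) {x :: real ^ 'p :: {finite, linorder} ^ 'n :: finite. uit_stat C x \<ge> u}) = \<alpha>"
  shows "\<not> proper_Bayes_test C {x :: real ^ 'p :: {finite, linorder} ^ 'n :: finite. uit_stat C x \<le> u}"
proof -
  \<comment> \<open>This coordinate is nonnegative on both cones; \<open>p \<ge> 2\<close> supplies
    a second coordinate \<open>j\<close>.\<close>
  define l :: 'p where "l = Max UNIV"
  have "UNIV \<noteq> {l}"
  proof
    assume "UNIV = {l}"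
    from arg_cong[OF this, of card] assms(1) show False by simp
  qed
  then obtain j where jl: "j \<noteq> l" by auto
  show ?thesis
  proof (rule not_proper_Bayes_test_uit[OF _ _ _ _ _ jl assms(2,6)])
    show "closed C"
      using assms(3) unfolding pos_orthant_def last_half_space_def
      by (auto intro!: closed_Collect_all closed_Collect_le continuous_intros)
  qed (use assms(3) in \<open>auto simp: pos_orthant_def last_half_space_def l_def less_imp_le\<close>)
qed

end
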